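(* Metric ATSP admits a linear $2$-additive lossy kernelization with respect to the parameter $k$, the number of one-way edges in a (given) minimum spanning arborescence.
   Context: Metric ATSP: given a simple complete directed graph $G=(V,E,c)$ with non-negative edge costs satisfying $c(u,v)+c(v,w)\ge c(u,w)$ for all $u,v,w\in V$, find a minimum-cost tour (directed cycle visiting each vertex exactly once). A spanning arborescence is a spanning directed tree with a root from which all vertices are reachable; a minimum spanning arborescence has minimum total cost. An edge $(u,v)$ is a one-way edge if $c(u,v)<c(v,u)$. Instances of the parameterized problem are pairs $(G,k)$. A solution is $\gamma$-approximate if its cost is at most $\gamma$ times optimal. For $\alpha\ge 0$, a linear $\alpha$-additive lossy kernelization is a pair of polynomial-time algorithms: (i) a kernelization algorithm mapping $(I,k)$ to an instance $(I',k')$ of the same problem with $|I'|+k'$ bounded by a linear function of $k$ ($|I'|$ = number of vertices); (ii) a solution lifting algorithm that, given $(I,k)$, $(I',k')$ and a $\gamma$-approximate solution for $(I',k')$, returns a $(\gamma+\alpha)$-approximate solution for $(I,k)$. *)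

theory Defs
  imports
    Complex_Main
    "HOL-Computational_Algebra.Polynomial"
    "Graph_Theory.Graph_Theory"
begin

section \<open>Machine model\<close>

text \<open>
  Polynomial time is measured by counting evaluation steps of programs in a first-order
  call-by-value language. Its data are binary trees whose leaves are either empty or carry a
  number. Numbers are atomic; they can only be added, subtracted and compared, each in one step,
  and the only numeric constants are 0 and 1. There is deliberately no multiplication, division
  or rounding and no other real constant: in polynomially many steps a program only forms integer
  combinations of its inputs with coefficients of polynomial bit length. Hence a polynomial
  step bound here implies polynomial Turing time whenever the input numbers are rationals in
  binary, while edge costs may still be arbitrary non-negative reals.
\<close>

datatype data = Num real | Leaf | Node data data

primrec data_size :: "data \<Rightarrow> nat" where
  "data_size (Num x) = 1"
| "data_size Leaf = 1"
| "data_size (Node a b) = data_size a + data_size b + 1"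

text \<open>
  \<open>EVar i\<close> is the \<open>i\<close>-th entry of the environment (\<open>ELet\<close> pushes onto its front);
  \<open>ECall f es\<close> runs the \<open>f\<close>-th function body of the program in the environment of the
  argument values, so functions may be mutually recursive.
\<close>

datatype expr =
    EVar nat
  | EZero
  | EOne
  | EPlus expr expr
  | EMinus expr expr
  | ELeaf
  | ENode expr expr
  | ELeft expr
  | ERight expr
  | EIfLess expr expr expr expr
  | EIfNode expr expr expr
  | ELet expr expr
  | ECall nat "expr list"

type_synonym prog = "expr list"

text \<open>
  \<open>eval P env e v t\<close>: in program \<open>P\<close>, expression \<open>e\<close> evaluates to \<open>v\<close> in exactly \<open>t\<close> steps.
  Ill-typed operations and divergent computations have no value.
\<close>

inductive eval :: "prog \<Rightarrow> data list \<Rightarrow> expr \<Rightarrow> data \<Rightarrow> nat \<Rightarrow> bool"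
  and evals :: "prog \<Rightarrow> data list \<Rightarrow> expr list \<Rightarrow> data list \<Rightarrow> nat \<Rightarrow> bool"
  for P :: prog
where
  Var: "i < length env \<Longrightarrow> eval P env (EVar i) (env ! i) 1"
| Zero: "eval P env EZero (Num 0) 1"
| One: "eval P env EOne (Num 1) 1"
| Plus: "eval P env a (Num x) s \<Longrightarrow> eval P env b (Num y) t \<Longrightarrow>
    eval P env (EPlus a b) (Num (x + y)) (s + t + 1)"
| Minus: "eval P env a (Num x) s \<Longrightarrow> eval P env b (Num y) t \<Longrightarrow>
    eval P env (EMinus a b) (Num (x - y)) (s + t + 1)"
| Leaf: "eval P env ELeaf Leaf 1"
| Node: "eval P env a v s \<Longrightarrow> eval P env b w t \<Longrightarrow>
    eval P env (ENode a b) (Node v w) (s + t + 1)"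
| Left: "eval P env a (Node v w) t \<Longrightarrow> eval P env (ELeft a) v (t + 1)"
| Right: "eval P env a (Node v w) t \<Longrightarrow> eval P env (ERight a) w (t + 1)"
| LessTrue: "eval P env a (Num x) s \<Longrightarrow> eval P env b (Num y) t \<Longrightarrow> x < y \<Longrightarrow>
    eval P env c v u \<Longrightarrow> eval P env (EIfLess a b c d) v (s + t + u + 1)"
| LessFalse: "eval P env a (Num x) s \<Longrightarrow> eval P env b (Num y) t \<Longrightarrow> \<not> x < y \<Longrightarrow>
    eval P env d v u \<Longrightarrow> eval P env (EIfLess a b c d) v (s + t + u + 1)"
| NodeTrue: "eval P env a (Node x y) s \<Longrightarrow> eval P env c v t \<Longrightarrow>
    eval P env (EIfNode a c d) v (s + t + 1)"
| NodeFalse: "eval P env a x s \<Longrightarrow> (\<And>y z. x \<noteq> Node y z) \<Longrightarrow> eval P env d v t \<Longrightarrow>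
    eval P env (EIfNode a c d) v (s + t + 1)"
| Let: "eval P env a x s \<Longrightarrow> eval P (x # env) b v t \<Longrightarrow>
    eval P env (ELet a b) v (s + t + 1)"
| Call: "f < length P \<Longrightarrow> evals P env es vs s \<Longrightarrow> eval P vs (P ! f) v t \<Longrightarrow>
    eval P env (ECall f es) v (s + t + 1)"
| Nil: "evals P env [] [] 0"
| Cons: "eval P env e v s \<Longrightarrow> evals P env es vs t \<Longrightarrow>
    evals P env (e # es) (v # vs) (s + t)"

lemma eval_deterministic:
  "eval P env e v t \<Longrightarrow> eval P env e v' t' \<Longrightarrow> v' = v \<and> t' = t"
  "evals P env es vs s \<Longrightarrow> evals P env es vs' s' \<Longrightarrow> vs' = vs \<and> s' = s"
proof (induction arbitrary: v' t' and vs' s' rule: eval_evals.inducts)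
  case Var from Var.prems show ?case by cases (use Var in auto)
next
  case Zero from Zero.prems show ?case by cases auto
next
  case One from One.prems show ?case by cases auto
next
  case Plus from Plus.prems show ?case by cases (auto dest!: Plus.IH(2,4))
next
  case Minus from Minus.prems show ?case by cases (auto dest!: Minus.IH(2,4))
next
  case Leaf from Leaf.prems show ?case by cases auto
next
  case Node from Node.prems show ?case by cases (auto dest!: Node.IH(2,4))
next
  case Left from Left.prems show ?case by cases (auto dest!: Left.IH(2))
next
  case Right from Right.prems show ?case by cases (auto dest!: Right.IH(2))
next
  case LessTrue
  from LessTrue.prems show ?case by cases (use LessTrue.hyps in \<open>auto dest!: LessTrue.IH(2,4,6)\<close>)
next
  case LessFalse
  from LessFalse.prems show ?case by cases (use LessFalse.hyps in \<open>auto dest!: LessFalse.IH(2,4,6)\<close>)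
next
  case NodeTrue
  from NodeTrue.prems show ?case by cases (auto dest!: NodeTrue.IH(2,4))
next
  case NodeFalse
  from NodeFalse.prems show ?case by cases (use NodeFalse.hyps in \<open>auto dest!: NodeFalse.IH(2,4)\<close>)
next
  case Let from Let.prems show ?case by cases (auto dest!: Let.IH(2,4))
next
  case Call from Call.prems show ?case by cases (auto dest!: Call.IH(3,5))
next
  case Nil from Nil.prems show ?case by cases auto
next
  case Cons from Cons.prems show ?case by cases (auto dest!: Cons.IH(2,4))
qed

definition runs :: "prog \<Rightarrow> data \<Rightarrow> data \<Rightarrow> nat \<Rightarrow> bool" where
  "runs P x y t \<longleftrightarrow> P \<noteq> [] \<and> eval P [x] (P ! 0) y t"

definition outputs :: "prog \<Rightarrow> data \<Rightarrow> data \<Rightarrow> bool" where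
  "outputs P x y \<longleftrightarrow> (\<exists>t. runs P x y t)"

text \<open>
  The size of the output is bounded as well, since subtrees are shared during evaluation and
  a value may thus be exponentially larger than the number of steps that built it.
\<close>

definition poly_time_on :: "data set \<Rightarrow> prog \<Rightarrow> bool" where
  "poly_time_on X P \<longleftrightarrow>
    (\<exists>p :: nat poly. \<forall>x\<in>X. \<exists>y t. runs P x y t \<and> t + data_size y \<le> poly p (data_size x))"


section \<open>Additive lossy kernelization\<close>

text \<open>Parameterized minimization problems with encodings of instances and solutions as data.\<close>

record ('i, 's) param_problem =
  is_inst :: "'i \<Rightarrow> nat \<Rightarrow> bool"
  is_sol :: "'i \<Rightarrow> 's \<Rightarrow> bool"
  sol_cost :: "'i \<Rightarrow> 's \<Rightarrow> real"
  inst_size :: "'i \<Rightarrow> nat"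
  enc_inst :: "'i \<Rightarrow> data"
  enc_sol :: "'s \<Rightarrow> data"

definition opt :: "('i, 's) param_problem \<Rightarrow> 'i \<Rightarrow> real" where
  "opt Q I = (INF s\<in>{s. is_sol Q I s}. sol_cost Q I s)"

definition approx_sol :: "('i, 's) param_problem \<Rightarrow> real \<Rightarrow> 'i \<Rightarrow> 's \<Rightarrow> bool" where
  "approx_sol Q \<gamma> I s \<longleftrightarrow> is_sol Q I s \<and> sol_cost Q I s \<le> \<gamma> * opt Q I"

definition enc_param :: "('i, 's) param_problem \<Rightarrow> 'i \<Rightarrow> nat \<Rightarrow> data" where
  "enc_param Q I k = Node (enc_inst Q I) (Num (real k))"

definition enc_lift :: "('i, 's) param_problem \<Rightarrow> 'i \<Rightarrow> nat \<Rightarrow> 'i \<Rightarrow> nat \<Rightarrow> 's \<Rightarrow> data" where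
  "enc_lift Q I k I' k' s =
    Node (enc_param Q I k) (Node (enc_param Q I' k') (enc_sol Q s))"

definition kernel_inputs :: "('i, 's) param_problem \<Rightarrow> data set" where
  "kernel_inputs Q = {enc_param Q I k | I k. is_inst Q I k}"

definition lift_inputs :: "('i, 's) param_problem \<Rightarrow> prog \<Rightarrow> data set" where
  "lift_inputs Q K = {enc_lift Q I k I' k' s | I k I' k' s.
     is_inst Q I k \<and> is_inst Q I' k' \<and>
     outputs K (enc_param Q I k) (enc_param Q I' k') \<and> is_sol Q I' s}"

definition linear_additive_lossy_kernelization ::
    "real \<Rightarrow> ('i, 's) param_problem \<Rightarrow> prog \<Rightarrow> prog \<Rightarrow> bool" where
  "linear_additive_lossy_kernelization \<alpha> Q K L \<longleftrightarrow>
    0 \<le> \<alpha> \<and>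
    poly_time_on (kernel_inputs Q) K \<and>
    (\<exists>a b :: nat. \<forall>I k. is_inst Q I k \<longrightarrow>
      (\<exists>I' k'. is_inst Q I' k' \<and> outputs K (enc_param Q I k) (enc_param Q I' k') \<and>
        inst_size Q I' + k' \<le> a * k + b)) \<and>
    poly_time_on (lift_inputs Q K) L \<and>
    (\<forall>I k I' k' s \<gamma>. is_inst Q I k \<longrightarrow> is_inst Q I' k' \<longrightarrow>
      outputs K (enc_param Q I k) (enc_param Q I' k') \<longrightarrow>
      0 \<le> \<gamma> \<longrightarrow> approx_sol Q \<gamma> I' s \<longrightarrow>
      (\<exists>s'. outputs L (enc_lift Q I k I' k' s) (enc_sol Q s') \<and>
        approx_sol Q (\<gamma> + \<alpha>) I s'))"

definition admits_linear_additive_lossy_kernelization ::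
    "real \<Rightarrow> ('i, 's) param_problem \<Rightarrow> bool" where
  "admits_linear_additive_lossy_kernelization \<alpha> Q \<longleftrightarrow>
    (\<exists>K L. linear_additive_lossy_kernelization \<alpha> Q K L)"


section \<open>Metric ATSP\<close>

definition complete_graph :: "nat \<Rightarrow> nat pair_pre_digraph" where
  "complete_graph n = \<lparr> pverts = {..<n}, parcs = {(u, v). u < n \<and> v < n \<and> u \<noteq> v} \<rparr>"

lemma complete_digraph_complete_graph:
  "complete_digraph n (with_proj (complete_graph n))"
  unfolding complete_digraph_pair_def by (auto simp: complete_graph_def)

definition metric_cost :: "('a, 'b) pre_digraph \<Rightarrow> ('a \<times> 'a) weight_fun \<Rightarrow> bool" where
  "metric_cost G c \<longleftrightarrow>
    (\<forall>e\<in>arcs_ends G. 0 \<le> c e) \<and>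
    (\<forall>u v w. (u, v) \<in> arcs_ends G \<longrightarrow> (v, w) \<in> arcs_ends G \<longrightarrow> (u, w) \<in> arcs_ends G \<longrightarrow>
      c (u, w) \<le> c (u, v) + c (v, w))"

text \<open>
  A directed graph is a tree with root \<open>r\<close> from which everything is reachable iff it has exactly
  one walk from \<open>r\<close> to each vertex. (The predicate \<open>spanning_tree\<close> of the graph library only
  excludes directed cycles, so a transitive tournament would satisfy it.)
\<close>

definition spanning_arborescence :: "('a, 'b) pre_digraph \<Rightarrow> ('a, 'b) pre_digraph \<Rightarrow> bool" where
  "spanning_arborescence H G \<longleftrightarrow>
    spanning H G \<and> (\<exists>r\<in>verts H. \<forall>v\<in>verts H. \<exists>!p. pre_digraph.awalk H r p v)"

definition min_spanning_arborescence ::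
    "'b weight_fun \<Rightarrow> ('a, 'b) pre_digraph \<Rightarrow> ('a, 'b) pre_digraph \<Rightarrow> bool" where
  "min_spanning_arborescence c H G \<longleftrightarrow>
    spanning_arborescence H G \<and>
    (\<forall>H'. spanning_arborescence H' G \<longrightarrow> sum c (arcs H) \<le> sum c (arcs H'))"

definition one_way :: "('a \<times> 'a) weight_fun \<Rightarrow> 'a \<times> 'a \<Rightarrow> bool" where
  "one_way c e \<longleftrightarrow> c e < c (snd e, fst e)"

text \<open>
  A tour is the list of arcs of a directed cycle. The graph with a single vertex has no cycle;
  there the empty tour, of cost 0, is the only solution.
\<close>

definition tour :: "nat \<Rightarrow> (nat \<times> nat) list \<Rightarrow> bool" where
  "tour n p \<longleftrightarrow>
    (if n = 1 then p = []
     else pre_digraph.cycle (with_proj (complete_graph n)) p \<and> fst ` set p = {..<n})"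

text \<open>
  Without loss of generality the vertices are \<open>0, ..., n - 1\<close>. The minimum spanning
  arborescence that defines the parameter is given as part of the instance by its arc set.
\<close>

record atsp_inst =
  vertex_count :: nat
  edge_cost :: "(nat \<times> nat) weight_fun"
  given_arborescence :: "(nat \<times> nat) set"

definition atsp_is_inst :: "atsp_inst \<Rightarrow> nat \<Rightarrow> bool" where
  "atsp_is_inst I k \<longleftrightarrow>
    (let n = vertex_count I; c = edge_cost I; T = given_arborescence I;
         G = with_proj (complete_graph n)
     in metric_cost G c \<and>
        min_spanning_arborescence c (with_proj \<lparr> pverts = {..<n}, parcs = T \<rparr>) G \<and>
        k = card {e \<in> T. one_way c e})"

definition enc_list :: "('a \<Rightarrow> data) \<Rightarrow> 'a list \<Rightarrow> data" where
  "enc_list f xs = foldr (\<lambda>x. Node (f x)) xs Leaf"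

definition enc_matrix :: "nat \<Rightarrow> (nat \<times> nat \<Rightarrow> real) \<Rightarrow> data" where
  "enc_matrix n f = enc_list (\<lambda>u. enc_list (\<lambda>v. Num (f (u, v))) [0..<n]) [0..<n]"

text \<open>Costs of loops are not part of the graph and are encoded as 0.\<close>

definition enc_atsp_inst :: "atsp_inst \<Rightarrow> data" where
  "enc_atsp_inst I =
    Node (Num (real (vertex_count I)))
      (Node (enc_matrix (vertex_count I) (\<lambda>(u, v). if u = v then 0 else edge_cost I (u, v)))
            (enc_matrix (vertex_count I) (\<lambda>e. if e \<in> given_arborescence I then 1 else 0)))"

definition enc_tour :: "(nat \<times> nat) list \<Rightarrow> data" where
  "enc_tour = enc_list (\<lambda>(u, v). Node (Num (real u)) (Num (real v)))"

definition metric_ATSP :: "(atsp_inst, (nat \<times> nat) list) param_problem" where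
  "metric_ATSP =
    \<lparr> is_inst = atsp_is_inst,
      is_sol = (\<lambda>I. tour (vertex_count I)),
      sol_cost = (\<lambda>I p. sum_list (map (edge_cost I) p)),
      inst_size = vertex_count,
      enc_inst = enc_atsp_inst,
      enc_sol = enc_tour \<rparr>"

end

theory Submission
  imports Defs "HOL-Library.Sublist"
begin

text \<open>
  Let \<open>N\<close> be the set of arcs of the given arborescence \<open>T\<close> that are not one-way. It is a forest,
  and each of its at most \<open>k + 1\<close> trees has a unique vertex without incoming arc in \<open>N\<close>. The kernel
  consists of these vertices. To obtain a minimum spanning arborescence for it without computing
  one, its costs are shifted by the potential \<open>v \<mapsto> c(r, v)\<close> for a kernel vertex \<open>r\<close>: tour costs
  stay the same, the star at \<open>r\<close> becomes free, and by the triangle inequality the costs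
  \<open>c(u, v) - c(r, v) + c(r, u)\<close> are non-negative.

  A kernel tour is lifted by inserting, as long as possible, a missing vertex \<open>v\<close> right after its
  parent \<open>u\<close> in \<open>N\<close>. By the triangle inequality this costs at most \<open>c(u, v) + c(v, u) \<le> 2 c(u, v)\<close>,
  hence at most \<open>2 c(T)\<close> in total, and \<open>c(T)\<close> is at most the optimum because a tour minus an arc
  is a spanning arborescence. Conversely, shortcutting a tour to the kernel vertices does not
  increase its cost, so the optimum of the kernel is at most that of the original instance.
\<close>

section \<open>Symbolic evaluation\<close>

text \<open>Only arcs that are not one-way bound the cost of the way back from a new vertex to its
  parent. So each one-way arc can force its head into the kernel, and the root is the one further
  vertex. The new parameter counts arcs of a star on the kernel vertices, hence it is bounded
  together with their number.

  The formal obstacle is the exact step count. Values and time are separated: \<open>sem\<close>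
  evaluates expressions with function calls as an oracle, so that the simplifier can run the
  programs, and the oracle answers only calls that finish within a budget fixed by their nesting
  depth. The depth stays below 8 and every loop runs over at most \<open>n\<close> entries,
  \<open>n\<close> being the number of vertices, so the budgets are polynomial.

  The lifting program sees the kernel only through its encoding, so its guarantee must hold for
  every instance encoded like the constructed one. Graphs with one vertex, whose only tour is empty,
  are treated uniformly by letting loops cost 0 in vertex lists.\<close>

fun sem :: "(nat \<Rightarrow> data list \<Rightarrow> data option) \<Rightarrow> data list \<Rightarrow> expr \<Rightarrow> data option"
  and sems :: "(nat \<Rightarrow> data list \<Rightarrow> data option) \<Rightarrow> data list \<Rightarrow> expr list \<Rightarrow> data list option" where
  "sem F env (EVar i) = (if i < length env then Some (env ! i) else None)"
| "sem F env EZero = Some (Num 0)"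
| "sem F env EOne = Some (Num 1)"
| "sem F env (EPlus a b) =
    (case (sem F env a, sem F env b) of (Some (Num x), Some (Num y)) \<Rightarrow> Some (Num (x + y)) | _ \<Rightarrow> None)"
| "sem F env (EMinus a b) =
    (case (sem F env a, sem F env b) of (Some (Num x), Some (Num y)) \<Rightarrow> Some (Num (x - y)) | _ \<Rightarrow> None)"
| "sem F env ELeaf = Some Leaf"
| "sem F env (ENode a b) =
    (case (sem F env a, sem F env b) of (Some x, Some y) \<Rightarrow> Some (Node x y) | _ \<Rightarrow> None)"
| "sem F env (ELeft a) = (case sem F env a of Some (Node x y) \<Rightarrow> Some x | _ \<Rightarrow> None)"
| "sem F env (ERight a) = (case sem F env a of Some (Node x y) \<Rightarrow> Some y | _ \<Rightarrow> None)"
| "sem F env (EIfLess a b c d) =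
    (case (sem F env a, sem F env b) of
      (Some (Num x), Some (Num y)) \<Rightarrow> if x < y then sem F env c else sem F env d | _ \<Rightarrow> None)"
| "sem F env (EIfNode a c d) =
    (case sem F env a of None \<Rightarrow> None | Some (Node x y) \<Rightarrow> sem F env c | Some _ \<Rightarrow> sem F env d)"
| "sem F env (ELet a b) = (case sem F env a of None \<Rightarrow> None | Some x \<Rightarrow> sem F (x # env) b)"
| "sem F env (ECall f es) = (case sems F env es of None \<Rightarrow> None | Some vs \<Rightarrow> F f vs)"
| "sems F env [] = Some []"
| "sems F env (e # es) =
    (case (sem F env e, sems F env es) of (Some v, Some vs) \<Rightarrow> Some (v # vs) | _ \<Rightarrow> None)"

text \<open>Time is measured in units of \<open>B + 1\<close>, where \<open>B\<close> is to bound
  every single call. A call together with its own step then costs one unit beyond its arguments, so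
  the number of units depends on the syntax of \<open>e\<close> alone.\<close>

definition eval_le :: "prog \<Rightarrow> nat \<Rightarrow> data list \<Rightarrow> expr \<Rightarrow> data \<Rightarrow> nat \<Rightarrow> bool" where
  "eval_le P B env e v n \<longleftrightarrow> (\<exists>t\<le>n * (B + 1). eval P env e v t)"

definition evals_le :: "prog \<Rightarrow> nat \<Rightarrow> data list \<Rightarrow> expr list \<Rightarrow> data list \<Rightarrow> nat \<Rightarrow> bool" where
  "evals_le P B env es vs n \<longleftrightarrow> (\<exists>t\<le>n * (B + 1). evals P env es vs t)"

lemma eval_le_leaf: "eval P env e v 1 \<Longrightarrow> 1 \<le> n \<Longrightarrow> eval_le P B env e v n"
  unfolding eval_le_def by (intro exI[of _ 1]) auto

lemma le_mult_Suc1: "s \<le> k * (B + 1) \<Longrightarrow> k + 1 \<le> n \<Longrightarrow> s + 1 \<le> n * (B + (1::nat))"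
proof -
  assume a: "s \<le> k * (B + 1)" "k + 1 \<le> n"
  have "s + 1 \<le> (k + 1) * (B + 1)" using a(1) by (simp add: algebra_simps)
  also have "\<dots> \<le> n * (B + 1)" by (rule mult_right_mono[OF a(2)]) simp
  finally show ?thesis .
qed

lemma le_mult_add: "s \<le> k * (B + 1) \<Longrightarrow> t \<le> l * (B + 1) \<Longrightarrow> s + t \<le> (k + l) * (B + (1::nat))"
  by (simp add: algebra_simps)

lemma eval_le_1:
  assumes "eval_le P B env a x k" "\<And>s. eval P env a x s \<Longrightarrow> eval P env e v (s + 1)" "k + 1 \<le> n"
  shows "eval_le P B env e v n"
  using assms(1,2) le_mult_Suc1[OF _ assms(3), of _ B] unfolding eval_le_def by blast

lemma eval_le_2:
  assumes "eval_le P B env a x k" "eval_le P B env' b y l"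
    "\<And>s t. eval P env a x s \<Longrightarrow> eval P env' b y t \<Longrightarrow> eval P env e v (s + t + 1)" "k + l + 1 \<le> n"
  shows "eval_le P B env e v n"
  using assms(1-3) le_mult_Suc1[OF le_mult_add assms(4)] unfolding eval_le_def by blast

lemma eval_le_3:
  assumes "eval_le P B env a x k" "eval_le P B env b y l" "eval_le P B env c z m"
    "\<And>s t u. eval P env a x s \<Longrightarrow> eval P env b y t \<Longrightarrow> eval P env c z u \<Longrightarrow>
      eval P env e v (s + t + u + 1)" "k + l + m + 1 \<le> n"
  shows "eval_le P B env e v n"
proof -
  obtain s t u where "s \<le> k * (B + 1)" "t \<le> l * (B + 1)" "u \<le> m * (B + 1)"
    "eval P env a x s" "eval P env b y t" "eval P env c z u"
    using assms(1-3) unfolding eval_le_def by blast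
  then show ?thesis
    using assms(4) le_mult_Suc1[OF le_mult_add[OF le_mult_add] assms(5), of s B t u]
    unfolding eval_le_def by blast
qed

lemma sems_sound:
  assumes "\<And>e env v. e \<in> set es \<Longrightarrow> sem F env e = Some v \<Longrightarrow> eval_le P B env e v (3 * size e + 1)"
    and "sems F env es = Some vs"
  shows "evals_le P B env es vs (3 * size_list size es)"
  using assms
proof (induction es arbitrary: vs)
  case Nil
  then show ?case by (auto simp: evals_le_def intro: eval_evals.Nil)
next
  case (Cons e es)
  from Cons.prems(2) obtain w ws where w: "sem F env e = Some w" "sems F env es = Some ws"
    and vs: "vs = w # ws" by (auto split: option.splits)
  from Cons.prems(1)[OF _ w(1)] obtain s where
    s: "s \<le> (3 * size e + 1) * (B + 1)" "eval P env e w s" unfolding eval_le_def by auto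
  from Cons.IH[OF _ w(2)] Cons.prems(1) obtain t where
    t: "t \<le> 3 * size_list size es * (B + 1)" "evals P env es ws t" unfolding evals_le_def by auto
  have "s + t \<le> (3 * size e + 1 + 3 * size_list size es) * (B + 1)"
    by (rule le_mult_add[OF s(1) t(1)])
  also have "\<dots> \<le> 3 * size_list size (e # es) * (B + 1)"
    by (rule mult_right_mono) auto
  finally show ?case
    unfolding evals_le_def vs using eval_evals.Cons[OF s(2) t(2)] by blast
qed

text \<open>The factor 3 stems from \<open>EIfLess\<close>: each of its three evaluated
  subexpressions contributes an extra unit and the test itself one more, four in all, against 3 for
  the constructor plus the final 1. In argument lists \<open>size_list\<close> adds one per entry,
  which pays for the \<open>+ 1\<close> of that entry.\<close>

lemma sem_sound:
  assumes F: "\<And>f vs v. F f vs = Some v \<Longrightarrow> f < length P \<and> (\<exists>t\<le>B. eval P vs (P ! f) v t)"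
  shows "sem F env e = Some v \<Longrightarrow> eval_le P B env e v (3 * size e + 1)"
proof (induction e arbitrary: env v)
  case (EVar i)
  then show ?case
    using eval_evals.Var[of i env P] by (auto intro!: eval_le_leaf split: if_splits)
next
  case EZero
  then show ?case using eval_evals.Zero by (auto intro!: eval_le_leaf)
next
  case EOne
  then show ?case using eval_evals.One by (auto intro!: eval_le_leaf)
next
  case (EPlus a b)
  from EPlus.prems obtain x y where "sem F env a = Some (Num x)" "sem F env b = Some (Num y)"
    and v: "v = Num (x + y)" by (auto split: option.splits data.splits)
  from EPlus.IH(1)[OF this(1)] EPlus.IH(2)[OF this(2)] show ?case
    unfolding v by (rule eval_le_2) (auto intro: eval_evals.Plus[simplified])
next
  case (EMinus a b)
  from EMinus.prems obtain x y where "sem F env a = Some (Num x)" "sem F env b = Some (Num y)"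
    and v: "v = Num (x - y)" by (auto split: option.splits data.splits)
  from EMinus.IH(1)[OF this(1)] EMinus.IH(2)[OF this(2)] show ?case
    unfolding v by (rule eval_le_2) (auto intro: eval_evals.Minus[simplified])
next
  case ELeaf
  then show ?case using eval_evals.Leaf by (auto intro!: eval_le_leaf)
next
  case (ENode a b)
  from ENode.prems obtain x y where "sem F env a = Some x" "sem F env b = Some y"
    and v: "v = Node x y" by (auto split: option.splits)
  from ENode.IH(1)[OF this(1)] ENode.IH(2)[OF this(2)] show ?case
    unfolding v by (rule eval_le_2) (auto intro: eval_evals.Node[simplified])
next
  case (ELeft a)
  from ELeft.prems obtain y where "sem F env a = Some (Node v y)"
    by (auto split: option.splits data.splits)
  from ELeft.IH[OF this] show ?case
    by (rule eval_le_1) (auto intro: eval_evals.Left[simplified])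
next
  case (ERight a)
  from ERight.prems obtain x where "sem F env a = Some (Node x v)"
    by (auto split: option.splits data.splits)
  from ERight.IH[OF this] show ?case
    by (rule eval_le_1) (auto intro: eval_evals.Right[simplified])
next
  case (EIfLess a b c d)
  from EIfLess.prems obtain x y where xy: "sem F env a = Some (Num x)" "sem F env b = Some (Num y)"
    and cd: "sem F env (if x < y then c else d) = Some v" by (auto split: option.splits data.splits if_splits)
  show ?case
  proof (cases "x < y")
    case True
    then have "sem F env c = Some v" using cd by simp
    from EIfLess.IH(1)[OF xy(1)] EIfLess.IH(2)[OF xy(2)] EIfLess.IH(3)[OF this] show ?thesis
      by (rule eval_le_3) (use True in \<open>auto intro: eval_evals.LessTrue[simplified]\<close>)
  next
    case False
    then have "sem F env d = Some v" using cd by simp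
    from EIfLess.IH(1)[OF xy(1)] EIfLess.IH(2)[OF xy(2)] EIfLess.IH(4)[OF this] show ?thesis
      by (rule eval_le_3) (use False in \<open>auto intro: eval_evals.LessFalse[simplified]\<close>)
  qed
next
  case (EIfNode a c d)
  from EIfNode.prems obtain x where x: "sem F env a = Some x" by (auto split: option.splits)
  show ?case
  proof (cases "\<exists>y z. x = Node y z")
    case True
    then obtain y z where yz: "x = Node y z" by blast
    then have "sem F env c = Some v" using EIfNode.prems x by simp
    from EIfNode.IH(1)[OF x[unfolded yz]] EIfNode.IH(2)[OF this] show ?thesis
      by (rule eval_le_2) (auto intro: eval_evals.NodeTrue[simplified])
  next
    case False
    then have "sem F env d = Some v" using EIfNode.prems x by (auto split: data.splits)
    from EIfNode.IH(1)[OF x] EIfNode.IH(3)[OF this] show ?thesis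
      by (rule eval_le_2) (use False in \<open>auto intro: eval_evals.NodeFalse[simplified]\<close>)
  qed
next
  case (ELet a b)
  from ELet.prems obtain x where "sem F env a = Some x" "sem F (x # env) b = Some v"
    by (auto split: option.splits)
  from ELet.IH(1)[OF this(1)] ELet.IH(2)[OF this(2)] show ?case
    by (rule eval_le_2) (auto intro: eval_evals.Let[simplified])
next
  case (ECall f es)
  from ECall.prems obtain vs where vs: "sems F env es = Some vs" and "F f vs = Some v"
    by (auto split: option.splits)
  from F[OF this(2)] obtain t where f: "f < length P" and t: "t \<le> B" "eval P vs (P ! f) v t"
    by blast
  from sems_sound[OF ECall.IH vs] obtain s where s: "s \<le> 3 * size_list size es * (B + 1)"
    "evals P env es vs s" unfolding evals_le_def by blast
  have "s + t + 1 \<le> (3 * size (ECall f es) + 1) * (B + 1)"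
    using s(1) t(1) by (simp add: algebra_simps)
  then show ?case
    unfolding eval_le_def using eval_evals.Call[OF f s(2) t(2)] by blast
qed

definition prog_weight :: "prog \<Rightarrow> nat" where
  "prog_weight P = (\<Sum>e\<leftarrow>P. 3 * size e + 1)"

lemma size_le_prog_weight: "e \<in> set P \<Longrightarrow> 3 * size e + 1 \<le> prog_weight P"
  unfolding prog_weight_def by (intro member_le_sum_list) auto

text \<open>
  Bounds the time of a function at nesting depth \<open>j\<close>: it only calls functions at lower depth,
  and in addition runs at most one loop, over a list of length at most \<open>n\<close>.
\<close>

primrec level_time :: "prog \<Rightarrow> nat \<Rightarrow> nat \<Rightarrow> nat" where
  "level_time P 0 n = 0"
| "level_time P (Suc j) n = (n + 1) * (prog_weight P * (level_time P j n + 1))"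

lemma level_time_Suc: "level_time P j n \<le> level_time P (Suc j) n"
proof (induction j)
  case (Suc j)
  show ?case
    unfolding level_time.simps(2)[of P "Suc j"] level_time.simps(2)[of P j]
    by (intro mult_left_mono add_right_mono Suc[unfolded level_time.simps]) auto
qed simp

lemma level_time_mono: "i \<le> j \<Longrightarrow> level_time P i n \<le> level_time P j n"
  using lift_Suc_mono_le[of "\<lambda>j. level_time P j n", OF level_time_Suc] .

text \<open>The oracle handed to \<open>sem\<close>. Success includes the time budget of depth
  \<open>j\<close>, so an equation \<open>call P n j f vs = Some v\<close> records value and running
  time at once. The description operator is harmless because evaluation is deterministic.\<close>

definition call :: "prog \<Rightarrow> nat \<Rightarrow> nat \<Rightarrow> nat \<Rightarrow> data list \<Rightarrow> data option" where
  "call P n j f vs =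
    (if f < length P \<and> (\<exists>v t. t \<le> level_time P j n \<and> eval P vs (P ! f) v t)
     then Some (THE v. \<exists>t. eval P vs (P ! f) v t) else None)"

lemma call_eq_Some_iff:
  "call P n j f vs = Some v \<longleftrightarrow> f < length P \<and> (\<exists>t\<le>level_time P j n. eval P vs (P ! f) v t)"
proof -
  have "(THE v. \<exists>t. eval P vs (P ! f) v t) = w" if "eval P vs (P ! f) w t" for w t
    by (rule the_equality) (use that eval_deterministic(1) in blast)+
  then show ?thesis unfolding call_def by auto
qed

lemma call_mono: "call P n i f vs = Some v \<Longrightarrow> i \<le> j \<Longrightarrow> call P n j f vs = Some v"
  unfolding call_eq_Some_iff using level_time_mono[of i j P n] by (meson order_trans)

lemma sem_call:
  "sem (call P n j) env e = Some v \<Longrightarrow>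
    eval_le P (level_time P j n) env e v (3 * size e + 1)"
  by (rule sem_sound) (auto simp: call_eq_Some_iff)

text \<open>One pass through a body takes at most \<open>prog_weight P\<close> units, so a function
  without recursion fits into the budget one level above the functions it calls.\<close>

lemma call_straight:
  assumes e: "P ! f = e" and "sem (call P n j) vs e = Some v" "f < length P" "j < i"
  shows "call P n i f vs = Some v"
proof -
  from sem_call[OF assms(2)[folded e]] obtain t where
    t: "t \<le> (3 * size (P ! f) + 1) * (level_time P j n + 1)" "eval P vs (P ! f) v t"
    unfolding eval_le_def by blast
  have "t \<le> (3 * size (P ! f) + 1) * (level_time P j n + 1)" by (rule t(1))
  also have "\<dots> \<le> prog_weight P * (level_time P j n + 1)"
    by (rule mult_right_mono[OF size_le_prog_weight]) (use assms(3) in auto)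
  also have "\<dots> \<le> level_time P (Suc j) n" by simp
  finally have "call P n (Suc j) f vs = Some v"
    using t(2) assms(3) by (auto simp: call_eq_Some_iff)
  then show ?thesis by (rule call_mono) (use assms(4) in simp)
qed

section \<open>Loops over lists\<close>

text \<open>
  A function computing a right fold over its first argument, with \<open>m\<close> further arguments; in
  \<open>step\<close>, entry 0 of the environment is the value for the tail and entry 1 is the list.
\<close>

definition loop :: "nat \<Rightarrow> nat \<Rightarrow> expr \<Rightarrow> expr \<Rightarrow> expr" where
  "loop f m base step =
    EIfNode (EVar 0) (ELet (ECall f (ERight (EVar 0) # map EVar [1..<Suc m])) step) base"

lemma evals_args: "evals P (d # as) (map EVar [1..<Suc (length as)]) as (length as)"
proof -
  have "evals P (xs @ ys) (map EVar [length xs..<length xs + length ys]) ys (length ys)" for xs ys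
  proof (induction ys arbitrary: xs)
    case Nil
    then show ?case by (simp add: eval_evals.Nil)
  next
    case (Cons y ys)
    have "eval P (xs @ y # ys) (EVar (length xs)) y 1"
      using eval_evals.Var[of "length xs" "xs @ y # ys" P] by simp
    moreover have "evals P (xs @ y # ys) (map EVar [Suc (length xs)..<length xs + length (y # ys)])
        ys (length ys)"
      using Cons[of "xs @ [y]"] by simp
    moreover have "map EVar [length xs..<length xs + length (y # ys)] =
        EVar (length xs) # map EVar [Suc (length xs)..<length xs + length (y # ys)]"
      by (subst upt_conv_Cons) auto
    ultimately show ?case
      using eval_evals.Cons[of P "xs @ y # ys" "EVar (length xs)" y 1] by simp
  qed
  from this[of "[d]" as] show ?thesis by simp
qed

text \<open>\<open>m + 6\<close> is the overhead of one iteration: one step for the tested variable,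
  two for taking the tail, one each for call, let and conditional, and \<open>m\<close> for passing
  on the other arguments.\<close>

lemma size_loop:
  "3 * size step + 1 + (m + 6) \<le> 3 * size (loop f m base step) + 1"
  "3 * size base + 1 + (m + 6) \<le> 3 * size (loop f m base step) + 1"
proof -
  have "size_list size (map EVar is) = length is" for "is" by (induction "is") auto
  then show "3 * size step + 1 + (m + 6) \<le> 3 * size (loop f m base step) + 1"
    "3 * size base + 1 + (m + 6) \<le> 3 * size (loop f m base step) + 1"
    unfolding loop_def by (simp_all del: upt_Suc)
qed

text \<open>The recursive call has the same depth as its caller, so the induction over the suffixes
  counts steps of \<open>eval\<close> directly; only \<open>base\<close> and \<open>step\<close> are
  evaluated with the oracle of depth \<open>j\<close>. Each of the at most \<open>n + 1\<close>
  passes costs one \<open>prog_weight\<close> of units, which is how \<open>level_time\<close>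
  grows. The suffix premise tells a step that its entry belongs to \<open>xs\<close>.\<close>

lemma call_loop:
  assumes loop: "P ! f = loop f m base step" and m: "length as = m" and f: "f < length P"
    and base: "sem (call P n j) (Leaf # as) base = Some (R [])"
    and step: "\<And>x ys. suffix (x # ys) xs \<Longrightarrow>
      sem (call P n j) (R ys # enc_list g (x # ys) # as) step = Some (R (x # ys))"
    and len: "length xs \<le> n" and ij: "j < i" and r: "R xs = r"
  shows "call P n i f (enc_list g xs # as) = Some r"
proof -
  note P = loop[folded m] f
  let ?B = "level_time P j n + 1" and ?W = "prog_weight P"
  have W: "3 * size (loop f (length as) base step) + 1 \<le> ?W"
    using size_le_prog_weight[OF nth_mem[OF P(2)]] unfolding P(1) .
  have "\<exists>t\<le>(length ys + 1) * (?W * ?B). eval P (enc_list g ys # as) (P ! f) (R ys) t"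
    if "suffix ys xs" for ys
    using that
  proof (induction ys)
    case Nil
    from sem_call[OF base] obtain t where
      t: "t \<le> (3 * size base + 1) * ?B" "eval P (Leaf # as) base (R []) t"
      unfolding eval_le_def by blast
    have "eval P (Leaf # as) (EVar 0) Leaf 1"
      using eval_evals.Var[of 0 "Leaf # as"] by simp
    from eval_evals.NodeFalse[OF this _ t(2)]
    have ev: "eval P (Leaf # as) (P ! f) (R []) (1 + t + 1)"
      unfolding P loop_def by simp
    have "1 + t + 1 \<le> (3 * size base + 1 + (length as + 6)) * ?B"
      using t(1) by (simp add: algebra_simps)
    also have "\<dots> \<le> ?W * ?B"
      by (rule mult_right_mono[OF order_trans[OF size_loop(2) W]]) simp
    finally have "1 + t + 1 \<le> (length [] + 1) * (?W * ?B)" by simp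
    with ev show ?case unfolding enc_list_def by (metis foldr.simps(1) id_apply)
  next
    case (Cons y ys)
    from Cons.prems have "suffix ys xs" by (metis suffix_ConsD)
    from Cons.IH[OF this] obtain t where t: "t \<le> (length ys + 1) * (?W * ?B)"
      "eval P (enc_list g ys # as) (P ! f) (R ys) t" by blast
    let ?env = "enc_list g (y # ys) # as"
    from sem_call[OF step[OF Cons.prems]] obtain s where
      s: "s \<le> (3 * size step + 1) * ?B" "eval P (R ys # ?env) step (R (y # ys)) s"
      unfolding eval_le_def by blast
    have v0: "eval P ?env (EVar 0) (Node (g y) (enc_list g ys)) 1"
      using eval_evals.Var[of 0 ?env] by (simp add: enc_list_def)
    have "evals P ?env (ERight (EVar 0) # map EVar [1..<Suc (length as)])
        (enc_list g ys # as) (1 + 1 + length as)"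
      by (rule eval_evals.Cons[OF eval_evals.Right[OF v0] evals_args])
    from eval_evals.NodeTrue[OF v0 eval_evals.Let[OF eval_evals.Call[OF P(2) this t(2)] s(2)]]
    have ev: "eval P ?env (P ! f) (R (y # ys)) (1 + (1 + 1 + length as + t + 1 + s + 1) + 1)"
      unfolding P loop_def .
    have "1 + (1 + 1 + length as + t + 1 + s + 1) + 1 \<le>
        (3 * size step + 1 + (length as + 6)) * ?B + t"
      using s(1) by (simp add: algebra_simps)
    also have "\<dots> \<le> ?W * ?B + (length ys + 1) * (?W * ?B)"
      by (rule add_mono[OF mult_right_mono[OF order_trans[OF size_loop(1) W]] t(1)]) simp
    also have "\<dots> = (length (y # ys) + 1) * (?W * ?B)" by (simp add: algebra_simps)
    finally show ?case using ev by blast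
  qed
  from this[of xs] obtain t where
    t: "t \<le> (length xs + 1) * (?W * ?B)" "eval P (enc_list g xs # as) (P ! f) (R xs) t"
    by auto
  have "t \<le> (length xs + 1) * (?W * ?B)" by (rule t(1))
  also have "\<dots> \<le> level_time P (Suc j) n"
    unfolding level_time.simps by (intro mult_right_mono) (use len in auto)
  finally have "call P n (Suc j) f (enc_list g xs # as) = Some (R xs)"
    using t(2) P(2) by (auto simp: call_eq_Some_iff)
  then have "call P n i f (enc_list g xs # as) = Some (R xs)"
    by (rule call_mono) (use ij in simp)
  then show ?thesis unfolding r .
qed

lemma enc_list_simps [simp]:
  "enc_list g [] = Leaf" "enc_list g (x # xs) = Node (g x) (enc_list g xs)"
  by (simp_all add: enc_list_def)

section \<open>Polynomial bounds\<close>

text \<open>Asking for the bound at all \<open>m\<close> above \<open>n\<close> builds monotonicity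
  in: budgets are functions of the vertex count, while the final polynomial is evaluated at the
  larger input size.\<close>

definition poly_bounded :: "(nat \<Rightarrow> nat) \<Rightarrow> bool" where
  "poly_bounded f \<longleftrightarrow> (\<exists>p :: nat poly. \<forall>n m. n \<le> m \<longrightarrow> f n \<le> poly p m)"

lemma poly_bounded_const [intro]: "poly_bounded (\<lambda>n. c)"
  unfolding poly_bounded_def by (intro exI[of _ "[:c:]"]) auto

lemma poly_bounded_id [intro]: "poly_bounded (\<lambda>n. n)"
  unfolding poly_bounded_def by (intro exI[of _ "[:0, 1:]"]) auto

lemma poly_bounded_add [intro]:
  assumes "poly_bounded f" "poly_bounded g"
  shows "poly_bounded (\<lambda>n. f n + g n)"
proof -
  from assms obtain p q where "\<forall>n m. n \<le> m \<longrightarrow> f n \<le> poly p m" "\<forall>n m. n \<le> m \<longrightarrow> g n \<le> poly q m"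
    unfolding poly_bounded_def by blast
  then show ?thesis
    unfolding poly_bounded_def by (intro exI[of _ "p + q"]) (auto intro: add_mono)
qed

lemma poly_bounded_mult [intro]:
  assumes "poly_bounded f" "poly_bounded g"
  shows "poly_bounded (\<lambda>n. f n * g n)"
proof -
  from assms obtain p q where "\<forall>n m. n \<le> m \<longrightarrow> f n \<le> poly p m" "\<forall>n m. n \<le> m \<longrightarrow> g n \<le> poly q m"
    unfolding poly_bounded_def by blast
  then show ?thesis
    unfolding poly_bounded_def by (intro exI[of _ "p * q"]) (auto intro: mult_mono)
qed

lemma poly_bounded_level_time [intro]: "poly_bounded (level_time P j)"
proof (induction j)
  case 0
  show ?case by (simp add: poly_bounded_const)
next
  case (Suc j)
  then show ?case unfolding level_time.simps by (intro poly_bounded_add poly_bounded_mult) auto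
qed

section \<open>Spanning arborescences\<close>

lemma awalk_with_proj:
  "pre_digraph.awalk (with_proj G) u p v \<longleftrightarrow> u \<in> pverts G \<and> set p \<subseteq> parcs G \<and> pcas u p v"
  by (simp add: pre_digraph.awalk_def cas_with_proj_eq)

lemma pcas_append: "pcas u (p @ q) v \<longleftrightarrow> (\<exists>w. pcas u p w \<and> pcas w q v)"
  by (induction p arbitrary: u) auto

lemma rtrancl_iff_pcas: "(u, v) \<in> T\<^sup>* \<longleftrightarrow> (\<exists>p. set p \<subseteq> T \<and> pcas u p v)"
proof
  assume "(u, v) \<in> T\<^sup>*"
  then show "\<exists>p. set p \<subseteq> T \<and> pcas u p v"
  proof (induction rule: rtrancl_induct)
    case base
    then show ?case by (intro exI[of _ "[]"]) simp
  next
    case (step v w)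
    then obtain p where "set p \<subseteq> T" "pcas u p v" by blast
    with step(2) show ?case by (intro exI[of _ "p @ [(v, w)]"]) (auto simp: pcas_append)
  qed
next
  assume "\<exists>p. set p \<subseteq> T \<and> pcas u p v"
  then obtain p where "set p \<subseteq> T" "pcas u p v" by blast
  then show "(u, v) \<in> T\<^sup>*"
  proof (induction p arbitrary: u)
    case (Cons e p)
    then show ?case by (cases e) (auto intro: converse_rtrancl_into_rtrancl)
  qed simp
qed

text \<open>Read backwards, a walk is forced: each vertex has at most one incoming arc, and none
  enters \<open>r\<close>, so both walks reach \<open>r\<close> after equally many steps.\<close>

lemma pcas_unique:
  assumes "\<And>u. (u, r) \<notin> T" "\<And>u u' v. (u, v) \<in> T \<Longrightarrow> (u', v) \<in> T \<Longrightarrow> u = u'"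
  shows "set p \<subseteq> T \<Longrightarrow> pcas r p v \<Longrightarrow> set q \<subseteq> T \<Longrightarrow> pcas r q v \<Longrightarrow> p = q"
proof (induction p arbitrary: q v rule: rev_induct)
  case Nil
  then show ?case
    using assms(1) by (cases q rule: rev_cases) (auto simp: pcas_append)
next
  case (snoc e p)
  obtain x y where e: "e = (x, y)" by (cases e)
  with snoc.prems have y: "y = v" and x: "pcas r p x" and T: "(x, v) \<in> T"
    by (auto simp: pcas_append)
  from T have "v \<noteq> r" using assms(1) by blast
  with snoc.prems(4) obtain q' e' where q: "q = q' @ [e']" by (cases q rule: rev_cases) auto
  with snoc.prems have "e' = (fst e', v)" "pcas r q' (fst e')" "(fst e', v) \<in> T"
    by (auto simp: pcas_append prod_eq_iff) (metis prod.collapse)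
  moreover from this T have "fst e' = x" using assms(2) by blast
  ultimately show ?case
    using snoc.IH[of x q'] snoc.prems q x e y by auto
qed

text \<open>A second arc into a vertex, or any arc into the root, would yield a second walk from the
  root. This turns the definition by unique walks into local conditions, which are easy to check for
  the kernel's star and for a tour without its closing arc.\<close>

lemma spanning_arborescence_complete_iff:
  "spanning_arborescence (with_proj \<lparr>pverts = {..<n}, parcs = T\<rparr>) (with_proj (complete_graph n)) \<longleftrightarrow>
    T \<subseteq> parcs (complete_graph n) \<and>
    (\<exists>r<n. (\<forall>u. (u, r) \<notin> T) \<and> (\<forall>u u' v. (u, v) \<in> T \<longrightarrow> (u', v) \<in> T \<longrightarrow> u = u') \<and>
      (\<forall>v<n. (r, v) \<in> T\<^sup>*))"
proof -
  let ?H = "\<lparr>pverts = {..<n}, parcs = T\<rparr>"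
  have sp: "spanning (with_proj ?H) (with_proj (complete_graph n)) \<longleftrightarrow> T \<subseteq> parcs (complete_graph n)"
    unfolding spanning_def subgraph_def wf_digraph_def
    by (auto simp: complete_graph_def compatible_def)
  have "(\<forall>v<n. \<exists>!p. set p \<subseteq> T \<and> pcas r p v) \<longleftrightarrow>
    (\<forall>u. (u, r) \<notin> T) \<and> (\<forall>u u' v. (u, v) \<in> T \<longrightarrow> (u', v) \<in> T \<longrightarrow> u = u') \<and> (\<forall>v<n. (r, v) \<in> T\<^sup>*)"
    if r: "r < n" and T: "T \<subseteq> parcs (complete_graph n)" for r
  proof (intro iffI conjI allI impI)
    assume *: "\<forall>v<n. \<exists>!p. set p \<subseteq> T \<and> pcas r p v"
    have ext: "\<exists>p. set p \<subseteq> T \<and> pcas r (p @ [(u, v)]) v" if "(u, v) \<in> T" for u v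
    proof -
      from that T have "u < n" by (auto simp: complete_graph_def)
      with * obtain p where "set p \<subseteq> T" "pcas r p u" by blast
      then show ?thesis by (intro exI[of _ p]) (auto simp: pcas_append)
    qed
    show "(u, r) \<notin> T" for u
    proof
      assume "(u, r) \<in> T"
      with ext obtain p where "set (p @ [(u, r)]) \<subseteq> T" "pcas r (p @ [(u, r)]) r" by fastforce
      moreover have "set [] \<subseteq> T" "pcas r [] r" by auto
      ultimately have "p @ [(u, r)] = []" using * r by blast
      then show False by simp
    qed
    show "u = u'" if uv: "(u, v) \<in> T" "(u', v) \<in> T" for u u' v
    proof -
      from ext[OF uv(1)] ext[OF uv(2)] uv obtain p q where
        "set (p @ [(u, v)]) \<subseteq> T" "pcas r (p @ [(u, v)]) v"
        "set (q @ [(u', v)]) \<subseteq> T" "pcas r (q @ [(u', v)]) v" by fastforce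
      moreover have "v < n" using T uv by (auto simp: complete_graph_def)
      ultimately have "p @ [(u, v)] = q @ [(u', v)]" using * by blast
      then show ?thesis by simp
    qed
    show "(r, v) \<in> T\<^sup>*" if "v < n" for v using * that unfolding rtrancl_iff_pcas by blast
  next
    fix v
    assume *: "(\<forall>u. (u, r) \<notin> T) \<and> (\<forall>u u' v. (u, v) \<in> T \<longrightarrow> (u', v) \<in> T \<longrightarrow> u = u') \<and>
      (\<forall>v<n. (r, v) \<in> T\<^sup>*)" and "v < n"
    then obtain p where "set p \<subseteq> T" "pcas r p v" unfolding rtrancl_iff_pcas by blast
    with pcas_unique[of r T] * show "\<exists>!p. set p \<subseteq> T \<and> pcas r p v" by blast
  qed
  then show ?thesis
    unfolding spanning_arborescence_def sp
    by (simp add: awalk_with_proj Bex_def Ball_def cong: conj_cong)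
qed

section \<open>Closed tours as vertex lists\<close>

text \<open>The arcs of the closed walk through \<open>xs\<close>. A single vertex \<open>x\<close>
  yields the loop \<open>(x, x)\<close>, a case to be reconciled with the empty tour.\<close>

definition cyclic_arcs :: "'a list \<Rightarrow> ('a \<times> 'a) list" where
  "cyclic_arcs xs = zip xs (rotate1 xs)"

lemma cyclic_arcs_Cons: "cyclic_arcs (x # xs) = zip (x # xs) (xs @ [x])"
  by (simp add: cyclic_arcs_def)

lemma map_fst_cyclic_arcs [simp]: "map fst (cyclic_arcs xs) = xs"
  by (simp add: cyclic_arcs_def)

lemma map_snd_cyclic_arcs [simp]: "map snd (cyclic_arcs xs) = rotate1 xs"
  by (simp add: cyclic_arcs_def)

lemma length_cyclic_arcs [simp]: "length (cyclic_arcs xs) = length xs"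
  by (simp add: cyclic_arcs_def)

lemma pcas_map_snd: "pcas u p v \<Longrightarrow> u # map snd p = map fst p @ [v]"
  by (induction p arbitrary: u) auto

lemma pcas_closed: "pcas u p u \<Longrightarrow> p = cyclic_arcs (map fst p)"
proof (cases p)
  case (Cons e q)
  assume "pcas u p u"
  from pcas_map_snd[OF this] Cons have "map snd p = rotate1 (map fst p)" by auto
  then show ?thesis unfolding cyclic_arcs_def by (metis zip_map_fst_snd)
qed (simp add: cyclic_arcs_def)

lemma pcas_zip: "pcas y (zip (y # zs) (zs @ [w])) w"
  by (induction zs arbitrary: y) auto

text \<open>For a closed tour \<open>w\<close> is the first vertex \<open>y\<close>; the two are
  kept apart because \<open>y\<close> changes in the induction. The last premise rules out the loop
  at a single vertex.\<close>

lemma zip_shift_neq: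
  "(a, b) \<in> set (zip (y # zs) (zs @ [w])) \<Longrightarrow> distinct (y # zs) \<Longrightarrow> w \<notin> set zs \<Longrightarrow>
    (zs = [] \<longrightarrow> w \<noteq> y) \<Longrightarrow> a \<noteq> b"
proof (induction zs arbitrary: y)
  case (Cons z zs)
  from Cons.prems(1) consider "a = y" "b = z" | "(a, b) \<in> set (zip (z # zs) (zs @ [w]))" by auto
  then show ?case
  proof cases
    case 2
    then show ?thesis by (rule Cons.IH) (use Cons.prems in auto)
  qed (use Cons.prems in auto)
qed auto

lemma pawalk_verts_conv: "pcas u p v \<Longrightarrow> tl (pawalk_verts u p) = map snd p"
proof -
  have "pawalk_verts u p = u # map snd p" if "pcas u p v"
    using that by (induction p arbitrary: u) auto
  then show "pcas u p v \<Longrightarrow> tl (pawalk_verts u p) = map snd p" by simp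
qed

lemma tour_iff:
  assumes "n \<noteq> 1"
  shows "tour n p \<longleftrightarrow> (\<exists>xs. xs \<noteq> [] \<and> distinct xs \<and> set xs = {..<n} \<and> p = cyclic_arcs xs)"
proof
  assume "tour n p"
  then obtain u where "pcas u p u" "distinct (tl (pawalk_verts u p))" "p \<noteq> []"
    "fst ` set p = {..<n}"
    using assms unfolding tour_def pre_digraph.cycle_def awalk_with_proj
    by (auto simp: awalk_verts_with_proj_eq)
  moreover from this have "distinct (map fst p)"
    using pcas_closed by (metis pawalk_verts_conv map_snd_cyclic_arcs distinct1_rotate)
  ultimately show "\<exists>xs. xs \<noteq> [] \<and> distinct xs \<and> set xs = {..<n} \<and> p = cyclic_arcs xs"
    using pcas_closed by (intro exI[of _ "map fst p"]) auto
next
  assume "\<exists>xs. xs \<noteq> [] \<and> distinct xs \<and> set xs = {..<n} \<and> p = cyclic_arcs xs"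
  then obtain y zs where xs: "distinct (y # zs)" "set (y # zs) = {..<n}"
    and p: "p = cyclic_arcs (y # zs)" by (metis list.exhaust)
  have "zs \<noteq> []"
  proof
    assume "zs = []"
    with xs(2) have "card {..<n} = card {y}" by simp
    with assms show False by simp
  qed
  have cas: "pcas y p y" unfolding p cyclic_arcs_Cons by (rule pcas_zip)
  have "set p \<subseteq> parcs (complete_graph n)"
  proof
    fix e assume e: "e \<in> set p"
    obtain a b where ab: "e = (a, b)" by (cases e)
    have "a \<noteq> b"
      using e[unfolded p cyclic_arcs_Cons ab] by (rule zip_shift_neq) (use xs \<open>zs \<noteq> []\<close> in auto)
    moreover have "a \<in> set (y # zs)" "b \<in> set (y # zs)"
      using e[unfolded p cyclic_arcs_Cons ab] by (auto dest: set_zip_leftD set_zip_rightD)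
    ultimately show "e \<in> parcs (complete_graph n)"
      unfolding xs(2) ab by (simp add: complete_graph_def)
  qed
  moreover have "y < n" using xs(2) by auto
  moreover have "distinct (tl (pawalk_verts y p))"
    using xs(1) unfolding pawalk_verts_conv[OF cas] unfolding p map_snd_cyclic_arcs by simp
  moreover have "fst ` set p = {..<n}"
    using xs(2) unfolding p by (metis list.set_map map_fst_cyclic_arcs)
  moreover have "p \<noteq> []" unfolding p cyclic_arcs_Cons by (cases zs) auto
  ultimately show "tour n p"
    using assms cas unfolding tour_def pre_digraph.cycle_def awalk_with_proj
    by (auto simp: awalk_verts_with_proj_eq complete_graph_def)
qed

definition tour_len :: "('a \<times> 'a \<Rightarrow> real) \<Rightarrow> 'a list \<Rightarrow> real" where
  "tour_len d xs = sum_list (map d (cyclic_arcs xs))"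

fun path_len :: "('a \<times> 'a \<Rightarrow> real) \<Rightarrow> 'a list \<Rightarrow> real" where
  "path_len d (x # y # zs) = d (x, y) + path_len d (y # zs)"
| "path_len d _ = 0"

lemma sum_list_zip_shift:
  "sum_list (map d (zip (y # zs) (zs @ [w]))) = path_len d (y # zs @ [w])"
  by (induction zs arbitrary: y) auto

lemma tour_len_conv: "tour_len d (x # xs) = path_len d (x # xs @ [x])"
  by (simp only: tour_len_def cyclic_arcs_Cons sum_list_zip_shift)

lemma path_len_append: "path_len d (as @ x # bs) = path_len d (as @ [x]) + path_len d (x # bs)"
proof (induction as)
  case (Cons a as)
  then show ?case by (cases as) auto
qed simp

text \<open>Allows a removal or an insertion anywhere in a tour to be analysed at the head of the
  list.\<close>

lemma tour_len_rotate: "tour_len d (as @ bs) = tour_len d (bs @ as)"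
proof (cases as)
  case Nil
  then show ?thesis by simp
next
  case as: (Cons x xs)
  show ?thesis
  proof (cases bs)
    case Nil
    then show ?thesis by simp
  next
    case (Cons y ys)
    show ?thesis
      using path_len_append[of d "x # xs" y "ys @ [x]"] path_len_append[of d "y # ys" x "xs @ [y]"]
      by (simp add: as Cons tour_len_conv)
  qed
qed

lemma sum_list_map_zip_diff:
  assumes "length xs = length ys"
  shows "sum_list (map (\<lambda>(a, b). d (a, b) - f b + f a) (zip xs ys)) =
    sum_list (map d (zip xs ys)) - sum_list (map f ys) + (sum_list (map f xs) :: real)"
  using assms by (induction xs ys rule: list_induct2) auto

text \<open>Every visited vertex starts one arc and ends one arc, so its potential is added once and
  subtracted once.\<close>

lemma tour_len_potential:
  "tour_len (\<lambda>(a, b). d (a, b) - f b + f a) xs = tour_len d xs"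
proof -
  have "sum_list (map f (rotate1 xs)) = sum_list (map f xs)" by (cases xs) auto
  then show ?thesis unfolding tour_len_def cyclic_arcs_def by (simp add: sum_list_map_zip_diff)
qed

lemma tour_len_map: "tour_len d (map f xs) = tour_len (\<lambda>(i, j). d (f i, f j)) xs"
  unfolding tour_len_def cyclic_arcs_def
  by (simp add: rotate1_map zip_map_map map_map o_def case_prod_unfold)

lemma tour_len_cong:
  assumes "\<And>a b. a \<in> set xs \<Longrightarrow> b \<in> set xs \<Longrightarrow> d (a, b) = d' (a, b)"
  shows "tour_len d xs = tour_len d' xs"
proof -
  have "map d (cyclic_arcs xs) = map d' (cyclic_arcs xs)"
  proof (rule map_cong[OF refl])
    fix e assume "e \<in> set (cyclic_arcs xs)"
    moreover obtain a b where e: "e = (a, b)" by (cases e)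
    ultimately have "a \<in> set xs" "b \<in> set xs"
      unfolding cyclic_arcs_def by (auto dest: set_zip_leftD set_zip_rightD)
    then show "d e = d' e" unfolding e by (rule assms)
  qed
  then show ?thesis unfolding tour_len_def by (rule arg_cong)
qed

text \<open>With distance 0 from a vertex to itself, the triangle inequality also covers coinciding
  vertices, so that very short tours need no separate treatment below.\<close>

locale directed_metric =
  fixes V :: "'a set" and d :: "'a \<times> 'a \<Rightarrow> real"
  assumes nonneg: "u \<in> V \<Longrightarrow> v \<in> V \<Longrightarrow> 0 \<le> d (u, v)"
    and self: "u \<in> V \<Longrightarrow> d (u, u) = 0"
    and triangle: "u \<in> V \<Longrightarrow> v \<in> V \<Longrightarrow> w \<in> V \<Longrightarrow> d (u, w) \<le> d (u, v) + d (v, w)"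
begin

lemma path_len_nonneg: "set xs \<subseteq> V \<Longrightarrow> 0 \<le> path_len d xs"
proof (induction xs rule: induct_list012)
  case (3 x y zs)
  then show ?case using nonneg[of x y] by auto
qed auto

lemma tour_len_nonneg: "set xs \<subseteq> V \<Longrightarrow> 0 \<le> tour_len d xs"
proof (cases xs)
  case (Cons x ys)
  assume "set xs \<subseteq> V"
  then show ?thesis unfolding Cons tour_len_conv by (intro path_len_nonneg) auto
qed (simp add: tour_len_def cyclic_arcs_def)

lemma tour_len_remove_hd:
  assumes "set (y # ds) \<subseteq> V" "ds \<noteq> []"
  shows "tour_len d ds \<le> tour_len d (y # ds)"
proof -
  obtain x xs where ds: "ds = x # xs" using assms(2) by (cases ds) auto
  \<comment> \<open>\<open>z\<close> and \<open>x\<close> are the neighbours of \<open>y\<close> on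
    the cycle; they coincide if \<open>ds\<close> has a single entry.\<close>
  obtain zs z where zs: "x # xs = zs @ [z]" by (metis rev_exhaust list.discI)
  have in_V: "x \<in> V" "y \<in> V" "z \<in> V" using assms(1) ds arg_cong[OF zs, of set] by auto
  have "tour_len d ds = path_len d (zs @ [z]) + d (z, x)"
    unfolding ds tour_len_conv using path_len_append[of d zs z "[x]"] zs
    by (metis append.assoc append_Cons append_Nil path_len.simps(1,3) add.right_neutral)
  moreover have "tour_len d (y # ds) = d (y, x) + (path_len d (zs @ [z]) + d (z, y))"
    unfolding ds tour_len_conv using path_len_append[of d zs z "[y]"] zs
    by (metis append.assoc append_Cons append_Nil path_len.simps(1,3) add.right_neutral)
  ultimately show ?thesis using triangle[of z y x] in_V by simp
qed

lemma tour_len_remove: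
  assumes "set (as @ y # bs) \<subseteq> V" "as @ bs \<noteq> []"
  shows "tour_len d (as @ bs) \<le> tour_len d (as @ y # bs)"
  using tour_len_remove_hd[of y "bs @ as"] assms
    tour_len_rotate[of d as bs] tour_len_rotate[of d as "y # bs"] by auto

lemma tour_len_filter:
  assumes "set xs \<subseteq> V" "filter P xs \<noteq> []"
  shows "tour_len d (filter P xs) \<le> tour_len d xs"
proof -
  \<comment> \<open>The length of a closed tour does not split over its sublists, so the part
    already filtered is carried along as the prefix \<open>as\<close>.\<close>
  have "tour_len d (as @ filter P bs) \<le> tour_len d (as @ bs)"
    if "set (as @ bs) \<subseteq> V" "as @ filter P bs \<noteq> []" for as bs
    using that
  proof (induction bs arbitrary: as)
    case (Cons b bs)
    show ?case
    proof (cases "P b")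
      case True
      then show ?thesis using Cons.IH[of "as @ [b]"] Cons.prems by simp
    next
      case False
      then have "tour_len d (as @ filter P bs) \<le> tour_len d (as @ bs)"
        using Cons.IH[of as] Cons.prems by simp
      also have "\<dots> \<le> tour_len d (as @ b # bs)"
        by (rule tour_len_remove) (use Cons.prems False in \<open>auto simp: filter_empty_conv\<close>)
      finally show ?thesis using False by simp
    qed
  qed simp
  from this[of "[]" xs] assms show ?thesis by simp
qed

lemma tour_len_insert:
  assumes "set (as @ u # v # bs) \<subseteq> V"
  shows "tour_len d (as @ u # v # bs) \<le> tour_len d (as @ u # bs) + d (u, v) + d (v, u)"
proof -
  let ?ds = "bs @ as"
  \<comment> \<open>\<open>w\<close> is the vertex that follows \<open>u\<close> on the old cycle,
    which is \<open>u\<close> itself if the tour has no other vertex. The new way from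
    \<open>v\<close> to \<open>w\<close> is compared with the one through \<open>u\<close>.\<close>
  obtain w ws where w: "?ds @ [u] = w # ws" by (metis append_is_Nil_conv list.exhaust not_Cons_self2)
  have in_V: "u \<in> V" "v \<in> V" "w \<in> V" using assms arg_cong[OF w, of set] by auto
  have "tour_len d (u # v # ?ds) = d (u, v) + (d (v, w) + path_len d (w # ws))"
    "tour_len d (u # ?ds) = d (u, w) + path_len d (w # ws)"
    using w by (simp_all add: tour_len_conv)
  then have "tour_len d (u # v # ?ds) \<le> tour_len d (u # ?ds) + d (u, v) + d (v, u)"
    using triangle[of v u w] in_V by simp
  then show ?thesis
    using tour_len_rotate[of d as "u # v # bs"] tour_len_rotate[of d as "u # bs"] by simp
qed

end

section \<open>Growing a tour along a forest\<close>

text \<open>Inserts \<open>v\<close> behind each of its parents; with unique parents and a distinct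
  list this is at most one place. The right fold is the shape that the programs compute.\<close>

definition insert_after :: "('a \<Rightarrow> 'a \<Rightarrow> bool) \<Rightarrow> 'a \<Rightarrow> 'a list \<Rightarrow> 'a list" where
  "insert_after N v L = foldr (\<lambda>u acc. u # (if N u v then v # acc else acc)) L []"

definition extend :: "('a \<Rightarrow> 'a \<Rightarrow> bool) \<Rightarrow> 'a \<Rightarrow> 'a list \<Rightarrow> 'a list" where
  "extend N v L = (if v \<in> set L then L else insert_after N v L)"

definition extend_all :: "('a \<Rightarrow> 'a \<Rightarrow> bool) \<Rightarrow> 'a list \<Rightarrow> 'a list \<Rightarrow> 'a list" where
  "extend_all N vs L = foldr (extend N) vs L"

text \<open>The list \<open>is\<close> is only a counter, in the form over which programs loop.
  Several rounds are made because a vertex is skipped while its parent is still missing.\<close>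

definition extend_rounds :: "('a \<Rightarrow> 'a \<Rightarrow> bool) \<Rightarrow> 'a list \<Rightarrow> 'b list \<Rightarrow> 'a list \<Rightarrow> 'a list" where
  "extend_rounds N vs is L = foldr (\<lambda>_. extend_all N vs) is L"

lemma insert_after_simps [simp]:
  "insert_after N v [] = []"
  "insert_after N v (u # L) = u # (if N u v then v # insert_after N v L else insert_after N v L)"
  by (simp_all add: insert_after_def)

lemma insert_after_append:
  "insert_after N v (as @ bs) = insert_after N v as @ insert_after N v bs"
  by (induction as) auto

lemma insert_after_id: "\<forall>u\<in>set L. \<not> N u v \<Longrightarrow> insert_after N v L = L"
  by (induction L) auto

lemma set_insert_after:
  "set (insert_after N v L) = set L \<union> (if \<exists>u\<in>set L. N u v then {v} else {})"
  by (induction L) auto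

lemma set_extend: "set (extend N v L) = set L \<union> (if \<exists>u\<in>set L. N u v then {v} else {})"
  unfolding extend_def by (auto simp: set_insert_after)

lemma set_extend_all:
  "set L \<subseteq> set (extend_all N vs L)"
  "v \<in> set vs \<Longrightarrow> u \<in> set L \<Longrightarrow> N u v \<Longrightarrow> v \<in> set (extend_all N vs L)"
proof -
  show *: "set L \<subseteq> set (extend_all N vs L)" for vs
    by (induction vs) (auto simp: extend_all_def set_extend)
  show "v \<in> set vs \<Longrightarrow> u \<in> set L \<Longrightarrow> N u v \<Longrightarrow> v \<in> set (extend_all N vs L)"
  proof (induction vs)
    case (Cons w vs)
    then show ?case
      using *[of vs] by (auto simp: extend_all_def set_extend)
  qed simp
qed

text \<open>\<open>N_back\<close> is what remains of arcs not being one-way. \<open>reach\<close> is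
  reachability from \<open>H\<close> along \<open>N\<close>, phrased for a loop that stops making
  progress: a set that no arc of \<open>N\<close> leaves is everything.\<close>

locale metric_forest = directed_metric +
  fixes N :: "'a \<Rightarrow> 'a \<Rightarrow> bool" and H :: "'a set"
  assumes finite_V: "finite V"
    and N_in_V: "N u v \<Longrightarrow> u \<in> V" "N u v \<Longrightarrow> v \<in> V"
    and N_back: "N u v \<Longrightarrow> d (v, u) \<le> d (u, v)"
    and N_unique: "N u v \<Longrightarrow> N u' v \<Longrightarrow> u = u'"
    and H_in_V: "H \<subseteq> V" and H_nonempty: "H \<noteq> {}"
    and reach: "H \<subseteq> S \<Longrightarrow> S \<subseteq> V \<Longrightarrow> (\<And>u v. u \<in> S \<Longrightarrow> N u v \<Longrightarrow> v \<in> S) \<Longrightarrow> S = V"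
begin

definition forest_cost :: "'a set \<Rightarrow> real" where
  "forest_cost S = sum d {(u, v). N u v \<and> v \<in> S}"

text \<open>The loop invariant, with \<open>B\<close> the length of the initial tour. A detour to
  \<open>v\<close> is charged to the arc of \<open>N\<close> entering \<open>v\<close>; charged arcs
  are identified by their heads on the tour, so none is charged twice.\<close>

definition grown :: "real \<Rightarrow> 'a list \<Rightarrow> bool" where
  "grown B L \<longleftrightarrow> distinct L \<and> H \<subseteq> set L \<and> set L \<subseteq> V \<and> tour_len d L \<le> B + 2 * forest_cost (set L)"

lemma finite_N: "finite {(u, v). N u v \<and> v \<in> S}"
  by (rule finite_subset[of _ "V \<times> V"]) (use N_in_V finite_V in auto)

lemma forest_cost_nonneg: "0 \<le> forest_cost S"
  unfolding forest_cost_def by (rule sum_nonneg) (use nonneg N_in_V in auto)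

lemma forest_cost_insert:
  assumes "N u v" "v \<notin> S"
  shows "forest_cost (insert v S) = d (u, v) + forest_cost S"
proof -
  have "{(u', w). N u' w \<and> w \<in> insert v S} = insert (u, v) {(u', w). N u' w \<and> w \<in> S}"
    using assms N_unique by auto
  then show ?thesis
    unfolding forest_cost_def using assms finite_N by simp
qed

lemma grown_extend:
  assumes "grown B L"
  shows "grown B (extend N v L)"
proof (cases "v \<in> set L \<or> (\<forall>u\<in>set L. \<not> N u v)")
  case True
  then have "extend N v L = L" by (auto simp: extend_def insert_after_id)
  then show ?thesis using assms by simp
next
  case False
  then obtain u where u: "u \<in> set L" "N u v" and v: "v \<notin> set L" by blast
  from u(1) obtain as bs where L: "L = as @ u # bs" by (metis split_list)
  have "u \<notin> set as" "u \<notin> set bs" using assms L by (auto simp: grown_def)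
  then have "\<forall>w\<in>set as. \<not> N w v" "\<forall>w\<in>set bs. \<not> N w v" using u(2) N_unique by blast+
  then have ext_eq: "extend N v L = as @ u # v # bs"
    using v u(2) unfolding extend_def L by (simp add: insert_after_append insert_after_id)
  have V: "set (as @ u # v # bs) \<subseteq> V" using assms N_in_V(2)[OF u(2)] by (auto simp: grown_def L)
  have "tour_len d (as @ u # v # bs) \<le> tour_len d L + 2 * d (u, v)"
    using tour_len_insert[OF V] N_back[OF u(2)] unfolding L by simp
  also have "\<dots> \<le> B + 2 * forest_cost (insert v (set L))"
    using assms unfolding forest_cost_insert[OF u(2) v] grown_def by simp
  also have "insert v (set L) = set (as @ u # v # bs)" unfolding L by auto
  finally have "grown B (as @ u # v # bs)"
    using assms v V unfolding grown_def L by auto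
  then show ?thesis unfolding ext_eq .
qed

lemma grown_extend_all: "grown B L \<Longrightarrow> grown B (extend_all N vs L)"
  by (induction vs) (auto simp: extend_all_def grown_extend)

lemma grown_extend_rounds: "grown B L \<Longrightarrow> grown B (extend_rounds N vs is L)"
  by (induction "is") (auto simp: extend_rounds_def grown_extend_all)

text \<open>If the tour is incomplete, \<open>reach\<close> provides an arc of \<open>N\<close>
  leaving it, and the next round inserts the head of that arc at the latest when it comes to
  it.\<close>

lemma card_extend_rounds:
  assumes "grown B L" "set vs = V"
  shows "set (extend_rounds N vs is L) = V \<or>
    card (set L) + length is \<le> card (set (extend_rounds N vs is L))"
proof (induction "is")
  case Nil
  then show ?case by (simp add: extend_rounds_def)
next
  case (Cons i "is")
  let ?L = "extend_rounds N vs is L"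
  have eq: "extend_rounds N vs (i # is) L = extend_all N vs ?L" by (simp add: extend_rounds_def)
  have g: "grown B ?L" "grown B (extend_all N vs ?L)"
    using assms grown_extend_rounds grown_extend_all by blast+
  show ?case
  proof (cases "set ?L = V")
    case True
    then show ?thesis
      using set_extend_all(1)[of ?L N vs] g(2) unfolding eq grown_def by blast
  next
    case False
    then obtain u v where uv: "u \<in> set ?L" "N u v" "v \<notin> set ?L"
      using reach[of "set ?L"] g(1) unfolding grown_def by blast
    then have "v \<in> set (extend_all N vs ?L)"
      using set_extend_all(2)[of v vs u ?L N] assms(2) N_in_V by blast
    with uv(3) have "set ?L \<subset> set (extend_all N vs ?L)"
      using set_extend_all(1)[of ?L N vs] by blast
    then have "card (set ?L) < card (set (extend_all N vs ?L))" by (simp add: psubset_card_mono)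
    then show ?thesis using Cons False unfolding eq by auto
  qed
qed

lemma extend_rounds_spans:
  assumes "distinct L" "set L = H" "set vs = V" "length is = card V"
  shows "distinct (extend_rounds N vs is L)" "set (extend_rounds N vs is L) = V"
    "tour_len d (extend_rounds N vs is L) \<le> tour_len d L + 2 * forest_cost V"
proof -
  have g0: "grown (tour_len d L) L"
    using assms H_in_V forest_cost_nonneg by (auto simp: grown_def)
  then have g: "grown (tour_len d L) (extend_rounds N vs is L)" by (rule grown_extend_rounds)
  \<comment> \<open>Starting with at least one vertex, \<open>card V\<close> rounds with progress
    would exceed \<open>card V\<close>, so the tour must have become complete.\<close>
  have "0 < card (set L)" using assms(2) H_nonempty by (auto simp: card_gt_0_iff)
  moreover have "card (set (extend_rounds N vs is L)) \<le> card V"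
    using g finite_V by (intro card_mono) (auto simp: grown_def)
  ultimately show V: "set (extend_rounds N vs is L) = V"
    using card_extend_rounds[OF g0 assms(3), of "is"] assms(4) by auto
  from g show "distinct (extend_rounds N vs is L)" by (simp add: grown_def)
  from g show "tour_len d (extend_rounds N vs is L) \<le> tour_len d L + 2 * forest_cost V"
    unfolding grown_def V by simp
qed

end

section \<open>The programs\<close>

definition length_fn :: expr where
  "length_fn =
    loop 1 0 EZero (EPlus (EVar 0) EOne)"

definition entry_fn :: expr where
  "entry_fn =
    ECall 7 [ECall 7 [EVar 0, EVar 1], EVar 2]"

definition keep_fn :: expr where
  "keep_fn =
    EIfLess EZero (ECall 2 [EVar 1, EVar 2, EVar 3])
    (EIfLess (ECall 2 [EVar 0, EVar 2, EVar 3]) (ECall 2 [EVar 0, EVar 3, EVar 2]) EZero EOne)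
    EZero"

text \<open>The argument list supplies only its length. The result is built from the back: its last
  entry is \<open>n - 1\<close>, and each earlier one is the head of the tail's value minus
  1.\<close>

definition indices_fn :: expr where
  "indices_fn =
    loop 4 1 ELeaf
    (EIfNode (EVar 0) (ENode (EMinus (ELeft (EVar 0)) EOne) (EVar 0))
      (ENode (EMinus (EVar 2) EOne) ELeaf))"

definition covered_fn :: expr where
  "covered_fn =
    loop 5 3 EZero (EIfLess EZero (ECall 3 [EVar 2, EVar 3, ELeft (EVar 1), EVar 4]) EOne (EVar 0))"

definition tops_fn :: expr where
  "tops_fn =
    loop 6 3 ELeaf
    (EIfLess EZero (ECall 5 [EVar 2, EVar 3, EVar 4, ELeft (EVar 1)]) (EVar 0)
      (ENode (ELeft (EVar 1)) (EVar 0)))"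

text \<open>Both arguments change in the recursion, so this is no instance of \<open>loop\<close>,
  and its time needs an induction of its own.\<close>

definition nth_fn :: expr where
  "nth_fn =
    EIfLess (EVar 1) EOne (ELeft (EVar 0)) (ECall 7 [ERight (EVar 0), EMinus (EVar 1) EOne])"

definition cost_row_fn :: expr where
  "cost_row_fn =
    loop 8 3 ELeaf
    (ENode
      (EPlus (EMinus (ECall 2 [EVar 2, EVar 4, ELeft (EVar 1)]) (ECall 2 [EVar 2, EVar 3, ELeft (EVar 1)]))
        (ECall 2 [EVar 2, EVar 3, EVar 4]))
      (EVar 0))"

definition cost_matrix_fn :: expr where
  "cost_matrix_fn =
    loop 9 3 ELeaf (ENode (ECall 8 [EVar 2, EVar 3, EVar 4, ELeft (EVar 1)]) (EVar 0))"

text \<open>Only \<open><\<close> is available for numbers. As \<open>r\<close> is going to be the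
  smallest kernel vertex, \<open>a \<le> r < b\<close> expresses that \<open>a\<close> is
  \<open>r\<close> and \<open>b\<close> is not, hence that \<open>(a, b)\<close> is an arc of the
  star.\<close>

definition star_row_fn :: expr where
  "star_row_fn =
    loop 10 2 ELeaf
    (ENode (EIfLess (EVar 2) (EVar 3) EZero (EIfLess (EVar 2) (ELeft (EVar 1)) EOne EZero)) (EVar 0))"

definition star_matrix_fn :: expr where
  "star_matrix_fn =
    loop 11 2 ELeaf (ENode (ECall 10 [EVar 2, EVar 3, ELeft (EVar 1)]) (EVar 0))"

text \<open>Computes the new parameter. After the shift the star arc \<open>(r, v)\<close> costs 0
  and its reverse \<open>c(v, r) + c(r, v)\<close>, so the arc is one-way iff this sum is positive;
  \<open>v = r\<close> contributes nothing.\<close>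

definition count_fn :: expr where
  "count_fn =
    loop 12 2 EZero
    (EIfLess EZero
      (EPlus (ECall 2 [EVar 2, ELeft (EVar 1), EVar 3]) (ECall 2 [EVar 2, EVar 3, ELeft (EVar 1)]))
      (EPlus (EVar 0) EOne) (EVar 0))"

definition starts_fn :: expr where
  "starts_fn =
    loop 13 1 ELeaf (ENode (ECall 7 [EVar 2, ELeft (ELeft (EVar 1))]) (EVar 0))"

definition member_fn :: expr where
  "member_fn =
    loop 14 1 EZero
    (EIfLess (ELeft (EVar 1)) (EVar 2) (EVar 0) (EIfLess (EVar 2) (ELeft (EVar 1)) (EVar 0) EOne))"

definition insert_fn :: expr where
  "insert_fn =
    loop 15 3 ELeaf
    (ENode (ELeft (EVar 1))
      (EIfLess EZero (ECall 3 [EVar 2, EVar 3, ELeft (EVar 1), EVar 4])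
        (ENode (EVar 4) (EVar 0)) (EVar 0)))"

definition extend_fn :: expr where
  "extend_fn =
    loop 16 3 (EVar 3)
    (EIfLess EZero (ECall 14 [EVar 0, ELeft (EVar 1)]) (EVar 0)
      (ECall 15 [EVar 0, EVar 2, EVar 3, ELeft (EVar 1)]))"

definition rounds_fn :: expr where
  "rounds_fn =
    loop 17 4 (EVar 4) (ECall 16 [EVar 2, EVar 3, EVar 4, EVar 0])"

text \<open>The next vertex is read off as the start of the first arc already built for the tail.
  For the last vertex there is no such arc, and the extra argument closes the cycle.\<close>

definition arcs_fn :: expr where
  "arcs_fn =
    loop 18 1 ELeaf
    (ENode (ENode (ELeft (EVar 1)) (EIfNode (EVar 0) (ELeft (ELeft (EVar 0))) (EVar 2))) (EVar 0))"

text \<open>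
  Entry \<open>i\<close> of \<open>lib\<close> is function \<open>i + 1\<close> of both programs, whose main functions have index 0.
\<close>

definition lib :: prog where
  "lib =
    [length_fn, entry_fn, keep_fn, indices_fn, covered_fn, tops_fn,
     nth_fn, cost_row_fn, cost_matrix_fn, star_row_fn, star_matrix_fn,
     count_fn, starts_fn, member_fn, insert_fn, extend_fn, rounds_fn, arcs_fn]"

text \<open>In the innermost body the environment holds, from index 0 on: \<open>r\<close>, the
  kernel vertices, \<open>[0..<n]\<close>, the tree matrix, the cost matrix, \<open>n\<close> and
  the input. A list is passed twice where it is both traversed and needed in full, since a loop
  consumes its first argument.\<close>

definition kernel_main :: expr where
  "kernel_main =
    ELet (ELeft (ELeft (EVar 0)))
    (ELet (ELeft (ERight (ELeft (EVar 1))))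
    (ELet (ERight (ERight (ELeft (EVar 2))))
    (ELet (ECall 4 [EVar 1, EVar 2])
    (ELet (ECall 6 [EVar 0, EVar 0, EVar 2, EVar 1])
    (ELet (ELeft (EVar 0))
    (ENode
      (ENode (ECall 1 [EVar 1])
        (ENode (ECall 9 [EVar 1, EVar 1, EVar 4, EVar 0]) (ECall 11 [EVar 1, EVar 1, EVar 0])))
      (ECall 12 [EVar 1, EVar 4, EVar 0])))))))"

text \<open>An empty kernel tour means that there is just one kernel vertex; the list of kernel
  vertices is then itself the vertex list to start from.\<close>

definition start_code :: expr where
  "start_code =
    EIfNode (ERight (ERight (EVar 5))) (ECall 13 [ERight (ERight (EVar 5)), EVar 0]) (EVar 0)"

definition close_code :: expr where
  "close_code = EIfNode (ERight (EVar 0)) (ECall 18 [EVar 0, ELeft (EVar 0)]) ELeaf"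

definition lift_main :: expr where
  "lift_main =
    ELet (ELeft (ELeft (ELeft (EVar 0))))
    (ELet (ELeft (ERight (ELeft (ELeft (EVar 1)))))
    (ELet (ERight (ERight (ELeft (ELeft (EVar 2)))))
    (ELet (ECall 4 [EVar 1, EVar 2])
    (ELet (ECall 6 [EVar 0, EVar 0, EVar 2, EVar 1])
    (ELet start_code
    (ELet (ECall 17 [EVar 2, EVar 2, EVar 4, EVar 3, EVar 0])
    close_code))))))"

lemma length_lib [simp]: "length lib = 18" by (simp add: lib_def)

lemma lib_nth:
  "(main # lib) ! 1 = length_fn"
  "(main # lib) ! 2 = entry_fn"
  "(main # lib) ! 3 = keep_fn"
  "(main # lib) ! 4 = indices_fn"
  "(main # lib) ! 5 = covered_fn"
  "(main # lib) ! 6 = tops_fn"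
  "(main # lib) ! 7 = nth_fn"
  "(main # lib) ! 8 = cost_row_fn"
  "(main # lib) ! 9 = cost_matrix_fn"
  "(main # lib) ! 10 = star_row_fn"
  "(main # lib) ! 11 = star_matrix_fn"
  "(main # lib) ! 12 = count_fn"
  "(main # lib) ! 13 = starts_fn"
  "(main # lib) ! 14 = member_fn"
  "(main # lib) ! 15 = insert_fn"
  "(main # lib) ! 16 = extend_fn"
  "(main # lib) ! 17 = rounds_fn"
  "(main # lib) ! 18 = arcs_fn"
  by (simp_all add: lib_def)

lemmas fn_defs =
  length_fn_def entry_fn_def keep_fn_def indices_fn_def covered_fn_def
  tops_fn_def nth_fn_def cost_row_fn_def cost_matrix_fn_def star_row_fn_def
  star_matrix_fn_def count_fn_def starts_fn_def member_fn_def insert_fn_def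
  extend_fn_def rounds_fn_def arcs_fn_def

lemmas lib_bodies = lib_nth[unfolded fn_defs]

section \<open>Values and nesting depths of the library functions\<close>

abbreviation enc_nats :: "nat list \<Rightarrow> data" where
  "enc_nats \<equiv> enc_list (\<lambda>v. Num (real v))"

text \<open>Membership in the forest \<open>N\<close> as the programs test it; for \<open>t\<close>
  the 0/1 matrix of the given arborescence is going to be used.\<close>

definition keep :: "(nat \<times> nat \<Rightarrow> real) \<Rightarrow> (nat \<times> nat \<Rightarrow> real) \<Rightarrow> nat \<Rightarrow> nat \<Rightarrow> bool" where
  "keep C t u v \<longleftrightarrow> 0 < t (u, v) \<and> \<not> C (u, v) < C (v, u)"

definition covered :: "(nat \<times> nat \<Rightarrow> real) \<Rightarrow> (nat \<times> nat \<Rightarrow> real) \<Rightarrow> nat \<Rightarrow> nat \<Rightarrow> bool" where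
  "covered C t n v \<longleftrightarrow> (\<exists>u<n. keep C t u v)"

lemma call_length:
  assumes "1 \<le> i" "length xs \<le> n"
  shows "call (main # lib) n i (Suc 0) [enc_list g xs] = Some (Num (real (length xs)))"
  by (rule call_loop[where R = "\<lambda>xs. Num (real (length xs))" and j = 0,
        OF lib_bodies(1)[unfolded One_nat_def]]) (use assms in auto)

lemma call_nth:
  assumes "i < length xs" "length xs \<le> n" "1 \<le> j"
  shows "call (main # lib) n j 7 [enc_list g xs, Num (real i)] = Some (g (xs ! i))"
proof -
  let ?P = "main # lib" and ?W = "prog_weight (main # lib)"
  have body: "?P ! 7 = nth_fn" by (rule lib_nth)
  \<comment> \<open>One recursive pass takes 9 steps besides the inner call, and the base case takes
    5, so one \<open>prog_weight\<close> pays for either.\<close>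
  have W: "10 \<le> ?W"
    using size_le_prog_weight[of nth_fn ?P] by (simp add: lib_def nth_fn_def)
  have "\<exists>t\<le>(i + 1) * ?W. eval ?P [enc_list g xs, Num (real i)] nth_fn (g (xs ! i)) t"
    using assms(1)
  proof (induction xs arbitrary: i)
    case (Cons x xs)
    let ?env = "[enc_list g (x # xs), Num (real i)]"
    have v0: "eval ?P ?env (EVar 0) (Node (g x) (enc_list g xs)) 1"
      using eval_evals.Var[of 0 ?env] by simp
    have v1: "eval ?P ?env (EVar 1) (Num (real i)) 1"
      using eval_evals.Var[of 1 ?env] by simp
    show ?case
    proof (cases i)
      case 0
      then have "eval ?P ?env nth_fn (g x) (1 + 1 + (1 + 1) + 1)"
        unfolding nth_fn_def
        by (intro eval_evals.LessTrue[OF v1 eval_evals.One] eval_evals.Left[OF v0]) auto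
      with 0 W show ?thesis by (intro exI[of _ "1 + 1 + (1 + 1) + 1"]) auto
    next
      case (Suc k)
      with Cons obtain t where t: "t \<le> (k + 1) * ?W"
        "eval ?P [enc_list g xs, Num (real k)] nth_fn (g (xs ! k)) t" by auto
      have "eval ?P ?env (EMinus (EVar 1) EOne) (Num (real k)) (1 + 1 + 1)"
        using eval_evals.Minus[OF v1 eval_evals.One] Suc by simp
      from eval_evals.Cons[OF eval_evals.Right[OF v0] eval_evals.Cons[OF this eval_evals.Nil]]
      have "evals ?P ?env [ERight (EVar 0), EMinus (EVar 1) EOne] [enc_list g xs, Num (real k)]
        (1 + 1 + (1 + 1 + 1 + 0))" .
      then have "eval ?P ?env (ECall 7 [ERight (EVar 0), EMinus (EVar 1) EOne]) (g (xs ! k))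
        (1 + 1 + (1 + 1 + 1 + 0) + t + 1)"
        by (rule eval_evals.Call[rotated]) (use t(2) body in simp_all)
      from eval_evals.LessFalse[OF v1 eval_evals.One _ this, of "ELeft (EVar 0)"] Suc
      have "eval ?P ?env nth_fn (g (xs ! k)) (1 + 1 + (1 + 1 + (1 + 1 + 1 + 0) + t + 1) + 1)"
        unfolding nth_fn_def by simp
      moreover have "1 + 1 + (1 + 1 + (1 + 1 + 1 + 0) + t + 1) + 1 \<le> (i + 1) * ?W" using t(1) W Suc by simp
      ultimately show ?thesis using Suc by auto
    qed
  qed simp
  then obtain t where t: "t \<le> (i + 1) * ?W" "eval ?P [enc_list g xs, Num (real i)] nth_fn (g (xs ! i)) t"
    by blast
  have "(i + 1) * ?W \<le> level_time ?P 1 n" using assms by (simp add: mult_right_mono)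
  with t(1) have "t \<le> level_time ?P 1 n" by (rule order_trans)
  with t(2) body have "call ?P n 1 7 [enc_list g xs, Num (real i)] = Some (g (xs ! i))"
    unfolding call_eq_Some_iff body by auto
  then show ?thesis using assms(3) by (rule call_mono)
qed

lemma call_entry:
  assumes "u < n" "v < n" "2 \<le> i"
  shows "call (main # lib) n i 2 [enc_matrix n C, Num (real u), Num (real v)] = Some (Num (C (u, v)))"
  by (rule call_straight[where j = 1, OF lib_bodies(2)])
    (use assms in \<open>simp_all add: enc_matrix_def call_nth del: upt_Suc\<close>)

lemma call_keep:
  assumes "u < n" "v < n" "3 \<le> i"
  shows "call (main # lib) n i 3 [enc_matrix n C, enc_matrix n t, Num (real u), Num (real v)] =
    Some (Num (of_bool (keep C t u v)))"
  by (rule call_straight[where j = 2, OF lib_bodies(3)])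
    (use assms in \<open>simp_all add: call_entry keep_def\<close>)

lemma call_indices:
  assumes "length xs = n" "1 \<le> i"
  shows "call (main # lib) n i 4 [enc_list g xs, Num (real n)] = Some (enc_nats [0..<n])"
proof (rule call_loop[where R = "\<lambda>xs. enc_nats [n - length xs..<n]" and j = 0, OF lib_bodies(4)])
  fix x ys
  assume "suffix (x # ys) xs"
  from suffix_length_le[OF this] assms have le: "Suc (length ys) \<le> n" by simp
  then show "sem (call (main # lib) n 0) (enc_nats [n - length ys..<n] # enc_list g (x # ys) # [Num (real n)])
      (EIfNode (EVar 0) (ENode (EMinus (ELeft (EVar 0)) EOne) (EVar 0))
        (ENode (EMinus (EVar 2) EOne) ELeaf)) =
    Some (enc_nats [n - length (x # ys)..<n])"
    by (cases ys) (auto simp: upt_conv_Cons Suc_diff_Suc simp del: upt_Suc)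
qed (use assms in auto)

lemma call_covered:
  assumes "v < n" "4 \<le> i"
  shows "call (main # lib) n i 5 [enc_nats [0..<n], enc_matrix n C, enc_matrix n t, Num (real v)] =
    Some (Num (of_bool (covered C t n v)))"
proof (rule call_loop[where R = "\<lambda>us. Num (of_bool (\<exists>u\<in>set us. keep C t u v))" and j = 3,
      OF lib_bodies(5)])
  fix x ys
  assume "suffix (x # ys) [0..<n]"
  from set_mono_suffix[OF this] have "x < n" by auto
  then show "sem (call (main # lib) n 3) (Num (of_bool (\<exists>u\<in>set ys. keep C t u v)) #
      enc_nats (x # ys) # [enc_matrix n C, enc_matrix n t, Num (real v)])
      (EIfLess EZero (ECall 3 [EVar 2, EVar 3, ELeft (EVar 1), EVar 4]) EOne (EVar 0)) =
    Some (Num (of_bool (\<exists>u\<in>set (x # ys). keep C t u v)))"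
    using assms by (simp add: call_keep)
qed (use assms in \<open>auto simp: covered_def\<close>)

lemma call_tops:
  assumes "5 \<le> i"
  shows "call (main # lib) n i 6 [enc_nats [0..<n], enc_nats [0..<n], enc_matrix n C, enc_matrix n t] =
    Some (enc_nats (filter (\<lambda>v. \<not> covered C t n v) [0..<n]))"
proof (rule call_loop[where R = "\<lambda>vs. enc_nats (filter (\<lambda>v. \<not> covered C t n v) vs)" and j = 4,
      OF lib_bodies(6)])
  fix x ys
  assume "suffix (x # ys) [0..<n]"
  from set_mono_suffix[OF this] have "x < n" by auto
  then show "sem (call (main # lib) n 4) (enc_nats (filter (\<lambda>v. \<not> covered C t n v) ys) #
      enc_nats (x # ys) # [enc_nats [0..<n], enc_matrix n C, enc_matrix n t])
      (EIfLess EZero (ECall 5 [EVar 2, EVar 3, EVar 4, ELeft (EVar 1)]) (EVar 0)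
        (ENode (ELeft (EVar 1)) (EVar 0))) =
    Some (enc_nats (filter (\<lambda>v. \<not> covered C t n v) (x # ys)))"
    by (simp add: call_covered)
qed (use assms in auto)

lemma call_cost_row:
  assumes "set hs \<subseteq> {..<n}" "length hs \<le> n" "r < n" "a < n" "3 \<le> i"
  shows "call (main # lib) n i 8 [enc_nats hs, enc_matrix n C, Num (real r), Num (real a)] =
    Some (enc_list (\<lambda>b. Num (C (a, b) - C (r, b) + C (r, a))) hs)"
proof (rule call_loop[where R = "enc_list (\<lambda>b. Num (C (a, b) - C (r, b) + C (r, a)))" and j = 2,
      OF lib_bodies(8)])
  fix x ys
  assume "suffix (x # ys) hs"
  from set_mono_suffix[OF this] assms have "x < n" by auto
  then show "sem (call (main # lib) n 2) (enc_list (\<lambda>b. Num (C (a, b) - C (r, b) + C (r, a))) ys #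
      enc_nats (x # ys) # [enc_matrix n C, Num (real r), Num (real a)])
      (ENode
        (EPlus (EMinus (ECall 2 [EVar 2, EVar 4, ELeft (EVar 1)]) (ECall 2 [EVar 2, EVar 3, ELeft (EVar 1)]))
          (ECall 2 [EVar 2, EVar 3, EVar 4]))
        (EVar 0)) =
    Some (enc_list (\<lambda>b. Num (C (a, b) - C (r, b) + C (r, a))) (x # ys))"
    using assms by (simp add: call_entry)
qed (use assms in auto)

lemma call_cost_matrix:
  assumes "set hs \<subseteq> {..<n}" "length hs \<le> n" "r < n" "4 \<le> i"
  shows "call (main # lib) n i 9 [enc_nats hs, enc_nats hs, enc_matrix n C, Num (real r)] =
    Some (enc_list (\<lambda>a. enc_list (\<lambda>b. Num (C (a, b) - C (r, b) + C (r, a))) hs) hs)"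
proof (rule call_loop[where j = 3 and
      R = "enc_list (\<lambda>a. enc_list (\<lambda>b. Num (C (a, b) - C (r, b) + C (r, a))) hs)", OF lib_bodies(9)])
  fix x ys
  assume "suffix (x # ys) hs"
  from set_mono_suffix[OF this] assms have "x < n" by auto
  then show "sem (call (main # lib) n 3)
      (enc_list (\<lambda>a. enc_list (\<lambda>b. Num (C (a, b) - C (r, b) + C (r, a))) hs) ys #
      enc_nats (x # ys) # [enc_nats hs, enc_matrix n C, Num (real r)])
      (ENode (ECall 8 [EVar 2, EVar 3, EVar 4, ELeft (EVar 1)]) (EVar 0)) =
    Some (enc_list (\<lambda>a. enc_list (\<lambda>b. Num (C (a, b) - C (r, b) + C (r, a))) hs) (x # ys))"
    using assms by (simp add: call_cost_row)
qed (use assms in auto)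

lemma call_star_row:
  assumes "length hs \<le> n" "1 \<le> i"
  shows "call (main # lib) n i 10 [enc_nats hs, Num (real r), Num (real a)] =
    Some (enc_list (\<lambda>b. Num (of_bool (a \<le> r \<and> r < b))) hs)"
  by (rule call_loop[where j = 0 and R = "enc_list (\<lambda>b. Num (of_bool (a \<le> r \<and> r < b)))",
      OF lib_bodies(10)]) (use assms in auto)

lemma call_star_matrix:
  assumes "length hs \<le> n" "2 \<le> i"
  shows "call (main # lib) n i 11 [enc_nats hs, enc_nats hs, Num (real r)] =
    Some (enc_list (\<lambda>a. enc_list (\<lambda>b. Num (of_bool (a \<le> r \<and> r < b))) hs) hs)"
  by (rule call_loop[where j = 1 and
      R = "enc_list (\<lambda>a. enc_list (\<lambda>b. Num (of_bool (a \<le> r \<and> r < b))) hs)", OF lib_bodies(11)])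
    (use assms in \<open>auto simp: call_star_row\<close>)

lemma call_count:
  assumes "set hs \<subseteq> {..<n}" "length hs \<le> n" "r < n" "3 \<le> i"
  shows "call (main # lib) n i 12 [enc_nats hs, enc_matrix n C, Num (real r)] =
    Some (Num (real (length (filter (\<lambda>v. 0 < C (v, r) + C (r, v)) hs))))"
proof (rule call_loop[where j = 2 and
      R = "\<lambda>hs. Num (real (length (filter (\<lambda>v. 0 < C (v, r) + C (r, v)) hs)))", OF lib_bodies(12)])
  fix x ys
  assume "suffix (x # ys) hs"
  from set_mono_suffix[OF this] assms have "x < n" by auto
  then show "sem (call (main # lib) n 2)
      (Num (real (length (filter (\<lambda>v. 0 < C (v, r) + C (r, v)) ys))) #
      enc_nats (x # ys) # [enc_matrix n C, Num (real r)])
      (EIfLess EZero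
        (EPlus (ECall 2 [EVar 2, ELeft (EVar 1), EVar 3]) (ECall 2 [EVar 2, EVar 3, ELeft (EVar 1)]))
        (EPlus (EVar 0) EOne) (EVar 0)) =
    Some (Num (real (length (filter (\<lambda>v. 0 < C (v, r) + C (r, v)) (x # ys)))))"
    using assms by (simp add: call_entry)
qed (use assms in auto)

lemma call_starts:
  assumes "fst ` set p \<subseteq> {..<length hs}" "length hs \<le> n" "length p \<le> n" "2 \<le> i"
  shows "call (main # lib) n i 13 [enc_tour p, enc_nats hs] = Some (enc_nats (map (\<lambda>e. hs ! fst e) p))"
  unfolding enc_tour_def
proof (rule call_loop[where j = 1 and R = "\<lambda>p. enc_nats (map (\<lambda>e. hs ! fst e) p)", OF lib_bodies(13)])
  fix x ys
  assume "suffix (x # ys) p"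
  from set_mono_suffix[OF this] assms have "fst x < length hs" by auto
  then show "sem (call (main # lib) n 1) (enc_nats (map (\<lambda>e. hs ! fst e) ys) #
      enc_list (\<lambda>(u, v). Node (Num (real u)) (Num (real v))) (x # ys) # [enc_nats hs])
      (ENode (ECall 7 [EVar 2, ELeft (ELeft (EVar 1))]) (EVar 0)) =
    Some (enc_nats (map (\<lambda>e. hs ! fst e) (x # ys)))"
    using assms by (cases x) (simp add: call_nth)
qed (use assms in auto)

lemma call_member:
  assumes "length L \<le> n" "1 \<le> i"
  shows "call (main # lib) n i 14 [enc_nats L, Num (real v)] = Some (Num (of_bool (v \<in> set L)))"
  by (rule call_loop[where j = 0 and R = "\<lambda>L. Num (of_bool (v \<in> set L))", OF lib_bodies(14)])
    (use assms in auto)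

lemma call_insert:
  assumes "set L \<subseteq> {..<n}" "length L \<le> n" "v < n" "4 \<le> i"
  shows "call (main # lib) n i 15 [enc_nats L, enc_matrix n C, enc_matrix n t, Num (real v)] =
    Some (enc_nats (insert_after (keep C t) v L))"
proof (rule call_loop[where j = 3 and R = "\<lambda>L. enc_nats (insert_after (keep C t) v L)",
      OF lib_bodies(15)])
  fix x ys
  assume "suffix (x # ys) L"
  from set_mono_suffix[OF this] assms have "x < n" by auto
  then show "sem (call (main # lib) n 3) (enc_nats (insert_after (keep C t) v ys) #
      enc_nats (x # ys) # [enc_matrix n C, enc_matrix n t, Num (real v)])
      (ENode (ELeft (EVar 1))
        (EIfLess EZero (ECall 3 [EVar 2, EVar 3, ELeft (EVar 1), EVar 4])
          (ENode (EVar 4) (EVar 0)) (EVar 0))) =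
    Some (enc_nats (insert_after (keep C t) v (x # ys)))"
    using assms by (simp add: call_keep)
qed (use assms in auto)

lemma call_extend_all:
  assumes "\<And>vs. set (extend_all (keep C t) vs L) \<subseteq> {..<n}"
    "\<And>vs. length (extend_all (keep C t) vs L) \<le> n" "5 \<le> i"
  shows "call (main # lib) n i 16 [enc_nats [0..<n], enc_matrix n C, enc_matrix n t, enc_nats L] =
    Some (enc_nats (extend_all (keep C t) [0..<n] L))"
proof (rule call_loop[where j = 4 and R = "\<lambda>vs. enc_nats (extend_all (keep C t) vs L)",
      OF lib_bodies(16)])
  fix x ys
  assume "suffix (x # ys) [0..<n]"
  from set_mono_suffix[OF this] have "x < n" by auto
  then show "sem (call (main # lib) n 4) (enc_nats (extend_all (keep C t) ys L) #
      enc_nats (x # ys) # [enc_matrix n C, enc_matrix n t, enc_nats L])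
      (EIfLess EZero (ECall 14 [EVar 0, ELeft (EVar 1)]) (EVar 0)
        (ECall 15 [EVar 0, EVar 2, EVar 3, ELeft (EVar 1)])) =
    Some (enc_nats (extend_all (keep C t) (x # ys) L))"
    using assms(1)[of ys] assms(2)[of ys]
    by (simp add: call_member call_insert) (simp add: extend_all_def extend_def)
qed (use assms in \<open>auto simp: extend_all_def\<close>)

text \<open>The time budget of the inner loops requires every intermediate tour to have at most
  \<open>n\<close> entries, and lookups require them to be vertices. Both are supplied by an
  abstract invariant \<open>I\<close>, later the invariant \<open>grown\<close>.\<close>

lemma call_extend_rounds:
  assumes inv: "I L" "\<And>L v. I L \<Longrightarrow> I (extend (keep C t) v L)"
      "\<And>L. I L \<Longrightarrow> set L \<subseteq> {..<n} \<and> length L \<le> n" and i: "6 \<le> i"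
  shows "call (main # lib) n i 17
      [enc_nats [0..<n], enc_nats [0..<n], enc_matrix n C, enc_matrix n t, enc_nats L] =
    Some (enc_nats (extend_rounds (keep C t) [0..<n] [0..<n] L))"
proof -
  have all: "I (extend_all (keep C t) vs L)" if "I L" for vs L
    using that by (induction vs) (auto simp: extend_all_def inv(2))
  have rounds: "I (extend_rounds (keep C t) vs is L)" for vs and "is" :: "nat list"
    using inv(1) by (induction "is") (auto simp: extend_rounds_def all)
  show ?thesis
  proof (rule call_loop[where j = 5 and
        R = "\<lambda>is. enc_nats (extend_rounds (keep C t) [0..<n] is L)", OF lib_bodies(17)])
    fix x ys
    show "sem (call (main # lib) n 5) (enc_nats (extend_rounds (keep C t) [0..<n] ys L) #
        enc_nats (x # ys) # [enc_nats [0..<n], enc_matrix n C, enc_matrix n t, enc_nats L])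
        (ECall 16 [EVar 2, EVar 3, EVar 4, EVar 0]) =
      Some (enc_nats (extend_rounds (keep C t) [0..<n] (x # ys) L))"
      using call_extend_all[of C t "extend_rounds (keep C t) [0..<n] ys L" n 5 main]
        inv(3)[OF all[OF rounds]] by (simp add: extend_rounds_def)
  qed (use i in \<open>auto simp: extend_rounds_def\<close>)
qed

lemma call_arcs:
  assumes "length xs \<le> n" "1 \<le> i"
  shows "call (main # lib) n i 18 [enc_nats xs, Num (real w)] = Some (enc_tour (zip xs (tl xs @ [w])))"
proof (rule call_loop[where j = 0 and R = "\<lambda>xs. enc_tour (zip xs (tl xs @ [w]))", OF lib_bodies(18)])
  fix x ys
  show "sem (call (main # lib) n 0) (enc_tour (zip ys (tl ys @ [w])) # enc_nats (x # ys) # [Num (real w)])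
      (ENode (ENode (ELeft (EVar 1)) (EIfNode (EVar 0) (ELeft (ELeft (EVar 0))) (EVar 2))) (EVar 0)) =
    Some (enc_tour (zip (x # ys) (tl (x # ys) @ [w])))"
    by (cases ys; cases "tl ys @ [w]") (auto simp: enc_tour_def)
qed (use assms in \<open>auto simp: enc_tour_def\<close>)

section \<open>The two main programs: outputs, running time, determinism\<close>

definition enc_input :: "nat \<Rightarrow> (nat \<times> nat \<Rightarrow> real) \<Rightarrow> (nat \<times> nat \<Rightarrow> real) \<Rightarrow> data \<Rightarrow> data" where
  "enc_input n C t k = Node (Node (Num (real n)) (Node (enc_matrix n C) (enc_matrix n t))) k"

definition tops :: "(nat \<times> nat \<Rightarrow> real) \<Rightarrow> (nat \<times> nat \<Rightarrow> real) \<Rightarrow> nat \<Rightarrow> nat list" where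
  "tops C t n = filter (\<lambda>v. \<not> covered C t n v) [0..<n]"

lemma set_tops: "set (tops C t n) \<subseteq> {..<n}" and length_tops: "length (tops C t n) \<le> n"
  by (auto simp: tops_def intro: order_trans[OF length_filter_le])

lemma call_tops':
  "5 \<le> i \<Longrightarrow> call (main # lib) n i 6 [enc_nats [0..<n], enc_nats [0..<n], enc_matrix n C, enc_matrix n t] =
    Some (enc_nats (tops C t n))"
  using call_tops unfolding tops_def .

lemma call_indices_matrix:
  "1 \<le> i \<Longrightarrow> call (main # lib) n i 4 [enc_matrix n C, Num (real n)] = Some (enc_nats [0..<n])"
  unfolding enc_matrix_def by (rule call_indices) auto

lemma case_enc_nats_Cons:
  "xs = x # ys \<Longrightarrow>
    (case enc_nats xs of Num z \<Rightarrow> None | Leaf \<Rightarrow> None | Node a b \<Rightarrow> Some a) = Some (Num (real x))"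
  by simp

lemma sem_kernel_main:
  assumes "tops C t n = r # rs" and hs: "hs = tops C t n"
  shows "sem (call (main # lib) n 6) [enc_input n C t k] kernel_main = Some
    (Node (Node (Num (real (length hs)))
      (Node (enc_list (\<lambda>a. enc_list (\<lambda>b. Num (C (a, b) - C (r, b) + C (r, a))) hs) hs)
        (enc_list (\<lambda>a. enc_list (\<lambda>b. Num (of_bool (a \<le> r \<and> r < b))) hs) hs)))
      (Num (real (length (filter (\<lambda>v. 0 < C (v, r) + C (r, v)) hs)))))"
proof -
  have r: "r < n" using set_tops[of C t n] assms by auto
  have H: "(case enc_nats hs of Num z \<Rightarrow> None | Leaf \<Rightarrow> None | Node a b \<Rightarrow> Some a) = Some (Num (real r))"
    using case_enc_nats_Cons assms by simp
  note hs' = set_tops[of C t n, folded hs] length_tops[of C t n, folded hs]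
  show ?thesis
    by (simp add: kernel_main_def enc_input_def call_indices_matrix call_tops' hs[symmetric] H
        call_length call_cost_matrix call_star_matrix call_count r hs' del: upt_Suc)
qed

lemma sem_lift_main:
  assumes "tops C t n = r # rs" and hs: "hs = tops C t n"
    and L0: "L\<^sub>0 = (if p = [] then hs else map (\<lambda>e. hs ! fst e) p)"
    and p: "fst ` set p \<subseteq> {..<length hs}" "length p \<le> n"
    and inv: "I L\<^sub>0" "\<And>L v. I L \<Longrightarrow> I (extend (keep C t) v L)"
      "\<And>L. I L \<Longrightarrow> set L \<subseteq> {..<n} \<and> length L \<le> n"
    and xs: "xs = extend_rounds (keep C t) [0..<n] [0..<n] L\<^sub>0" "xs \<noteq> []" "length xs \<le> n"
  shows "sem (call (main # lib) n 6) [Node (enc_input n C t k) (Node y (enc_tour p))] lift_main =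
    Some (enc_tour (if length xs = 1 then [] else cyclic_arcs xs))"
proof -
  have L: "sem F [enc_nats hs, a1, a2, a3, a4, Node x1 (Node x2 (enc_tour p))]
    start_code =
    Some (enc_nats L\<^sub>0)" if "F = call (main # lib) n 6" for F a1 a2 a3 a4 x1 x2
  proof (cases p)
    case Nil
    then show ?thesis by (simp add: start_code_def enc_tour_def L0)
  next
    case (Cons e q)
    then have "enc_tour p = Node (Node (Num (real (fst e))) (Num (real (snd e)))) (enc_tour q)"
      by (simp add: enc_tour_def case_prod_unfold)
    with Cons call_starts[OF p(1) length_tops[of C t n, folded hs] p(2), of 6 main] that
    show ?thesis by (simp add: start_code_def L0)
  qed
  have X: "sem F [enc_nats xs, a0, a1, a2, a3, a4, a5, a6]
    close_code =
    Some (enc_tour (if length xs = 1 then [] else cyclic_arcs xs))"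
    if "F = call (main # lib) n 6" for F a0 a1 a2 a3 a4 a5 a6
  proof -
    obtain x ys where x: "xs = x # ys" using xs(2) by (cases xs) auto
    show ?thesis
    proof (cases ys)
      case Nil
      then show ?thesis using x by (simp add: close_code_def enc_tour_def)
    next
      case (Cons y zs)
      then show ?thesis
        using call_arcs[of xs n 6 main x] x xs(3) that by (simp add: close_code_def cyclic_arcs_Cons)
    qed
  qed
  show ?thesis
    unfolding lift_main_def enc_input_def
    by (simp add: call_indices_matrix call_tops' hs[symmetric] L X
      call_extend_rounds[of I, OF inv] xs(1)[symmetric] del: upt_Suc)
qed

text \<open>Level 6 is the depth of \<open>rounds_fn\<close>, the most deeply nested library
  function, so the main function fits into level 7. With the level fixed, the budget is a polynomial
  in \<open>n\<close>.\<close>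

lemma poly_time_onI:
  assumes b: "poly_bounded b"
    and X: "\<And>x. x \<in> X \<Longrightarrow> \<exists>n y. n \<le> data_size x \<and> sem (call (main # lib) n 6) [x] main = Some y \<and>
      data_size y \<le> b n"
  shows "poly_time_on X (main # lib)"
proof -
  let ?f = "\<lambda>n. level_time (main # lib) 7 n + b n"
  have "poly_bounded ?f" using b by (intro poly_bounded_add poly_bounded_level_time)
  then obtain p where p: "\<And>n m. n \<le> m \<Longrightarrow> ?f n \<le> poly p m" unfolding poly_bounded_def by blast
  have "\<exists>y t. runs (main # lib) x y t \<and> t + data_size y \<le> poly p (data_size x)" if x: "x \<in> X" for x
  proof -
    from X[OF x] obtain n y where n: "n \<le> data_size x" and
      s: "sem (call (main # lib) n 6) [x] main = Some y" and y: "data_size y \<le> b n" by blast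
    have "call (main # lib) n 7 0 [x] = Some y"
      by (rule call_straight[OF _ s]) auto
    then obtain t where "t \<le> level_time (main # lib) 7 n" "runs (main # lib) x y t"
      unfolding call_eq_Some_iff runs_def by auto
    with y p[OF n] show ?thesis by (intro exI[of _ y] exI[of _ t]) auto
  qed
  then show ?thesis unfolding poly_time_on_def by blast
qed

lemma outputs_main:
  assumes "sem (call (main # lib) n 6) [x] main = Some y"
  shows "outputs (main # lib) x z \<longleftrightarrow> z = y"
proof -
  have "call (main # lib) n 7 0 [x] = Some y"
    by (rule call_straight[OF _ assms]) auto
  then obtain t where "runs (main # lib) x y t"
    unfolding call_eq_Some_iff runs_def by auto
  then show ?thesis
    unfolding outputs_def runs_def using eval_deterministic(1) by blast
qed

section \<open>Tours and their optimal cost\<close>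

text \<open>Agrees with the encoding, which writes 0 on the diagonal, and gives the loop of a
  one-vertex tour the cost 0 of the empty tour.\<close>

definition zero_diag :: "('a \<times> 'a \<Rightarrow> real) \<Rightarrow> 'a \<times> 'a \<Rightarrow> real" where
  "zero_diag c = (\<lambda>(u, v). if u = v then 0 else c (u, v))"

definition tour_of :: "'a list \<Rightarrow> ('a \<times> 'a) list" where
  "tour_of xs = (if length xs = 1 then [] else cyclic_arcs xs)"

lemma sum_list_zip_tl: "sum_list (map d (zip (x # ys) ys)) = path_len d (x # ys)"
  by (induction ys arbitrary: x) auto

lemma tour_subset:
  assumes "tour n p"
  shows "set p \<subseteq> parcs (complete_graph n)"
  using assms by (auto simp: tour_def pre_digraph.cycle_def awalk_with_proj split: if_splits)

lemma tour_iff_tour_of: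
  "tour n p \<longleftrightarrow> (\<exists>xs. xs \<noteq> [] \<and> distinct xs \<and> set xs = {..<n} \<and> p = tour_of xs)"
proof (cases "n = 1")
  case True
  have "\<exists>xs. xs \<noteq> [] \<and> distinct xs \<and> set xs = {..<n} \<and> [] = tour_of xs"
    using True by (intro exI[of _ "[0]"]) (auto simp: tour_of_def)
  moreover have "tour_of xs = []" if "distinct xs" "set xs = {..<n}" for xs
    using distinct_card[OF that(1)] that(2) True by (simp add: tour_of_def)
  ultimately show ?thesis using True by (auto simp: tour_def)
next
  case False
  have "tour_of xs = cyclic_arcs xs" if "distinct xs" "set xs = {..<n}" for xs
    using distinct_card[OF that(1)] that(2) False by (simp add: tour_of_def)
  then show ?thesis unfolding tour_iff[OF False] by metis
qed

lemma cost_tour_of: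
  fixes xs :: "nat list"
  assumes "distinct xs" "set xs = {..<n}" "xs \<noteq> []"
  shows "sum_list (map c (tour_of xs)) = tour_len (zero_diag c) xs"
proof (cases "length xs = 1")
  case True
  then obtain x where "xs = [x]" by (cases xs) auto
  then show ?thesis
    by (simp add: tour_of_def tour_len_def cyclic_arcs_def zero_diag_def)
next
  case False
  have "tour n (tour_of xs)" using assms tour_iff_tour_of by blast
  from tour_subset[OF this] have "map c (tour_of xs) = map (zero_diag c) (tour_of xs)"
    by (auto simp: complete_graph_def zero_diag_def)
  moreover have "tour_of xs = cyclic_arcs xs" using False by (simp add: tour_of_def)
  ultimately show ?thesis unfolding tour_len_def by metis
qed

lemma metric_ATSP_simps [simp]:
  "is_inst metric_ATSP = atsp_is_inst"
  "is_sol metric_ATSP I p = tour (vertex_count I) p"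
  "sol_cost metric_ATSP I p = sum_list (map (edge_cost I) p)"
  "inst_size metric_ATSP = vertex_count"
  "enc_inst metric_ATSP = enc_atsp_inst"
  "enc_sol metric_ATSP = enc_tour"
  by (simp_all add: metric_ATSP_def)

lemma enc_list_nth: "enc_list f xs = enc_list (\<lambda>i. f (xs ! i)) [0..<length xs]"
proof -
  have "enc_list f (map g ys) = enc_list (\<lambda>i. f (g i)) ys" for g :: "nat \<Rightarrow> _" and ys
    by (induction ys) auto
  from this[of "(!) xs" "[0..<length xs]"] show ?thesis by (simp add: map_nth)
qed

lemma enc_list_cong: "(\<And>x. x \<in> set xs \<Longrightarrow> f x = g x) \<Longrightarrow> enc_list f xs = enc_list g xs"
  by (induction xs) auto

section \<open>An instance: its metric, its forest and its optimum\<close>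

locale atsp_instance =
  fixes I :: atsp_inst and k :: nat
  assumes inst: "atsp_is_inst I k"
begin

abbreviation "n \<equiv> vertex_count I"
abbreviation "T \<equiv> given_arborescence I"

definition C :: "nat \<times> nat \<Rightarrow> real" where
  "C = zero_diag (edge_cost I)"

definition t :: "nat \<times> nat \<Rightarrow> real" where
  "t = (\<lambda>e. if e \<in> T then 1 else 0)"

abbreviation "N \<equiv> keep C t"

definition hs :: "nat list" where
  "hs = tops C t n"

definition r :: nat where
  "r = hd hs"

lemma metric: "metric_cost (with_proj (complete_graph n)) (edge_cost I)"
  and min_arb: "min_spanning_arborescence (edge_cost I) (with_proj \<lparr>pverts = {..<n}, parcs = T\<rparr>)
    (with_proj (complete_graph n))"
  and k_eq: "k = card {e \<in> T. one_way (edge_cost I) e}"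
  using inst by (auto simp: atsp_is_inst_def Let_def)

lemma T_subset: "T \<subseteq> parcs (complete_graph n)"
  and arborescence: "\<exists>r<n. (\<forall>u. (u, r) \<notin> T) \<and> (\<forall>u u' v. (u, v) \<in> T \<longrightarrow> (u', v) \<in> T \<longrightarrow> u = u') \<and>
      (\<forall>v<n. (r, v) \<in> T\<^sup>*)"
  using min_arb unfolding min_spanning_arborescence_def spanning_arborescence_complete_iff by auto

lemma finite_T: "finite T"
  by (rule finite_subset[OF T_subset], rule finite_subset[of _ "{..<n} \<times> {..<n}"])
    (auto simp: complete_graph_def)

sublocale directed_metric "{..<n}" C
proof
  have c: "u < n \<Longrightarrow> v < n \<Longrightarrow> u \<noteq> v \<Longrightarrow> 0 \<le> edge_cost I (u, v)" for u v
    using metric by (auto simp: metric_cost_def complete_graph_def)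
  then show "0 \<le> C (u, v)" if "u \<in> {..<n}" "v \<in> {..<n}" for u v
    using that by (auto simp: C_def zero_diag_def)
  show "C (u, u) = 0" for u by (simp add: C_def zero_diag_def)
  show "C (u, w) \<le> C (u, v) + C (v, w)" if "u \<in> {..<n}" "v \<in> {..<n}" "w \<in> {..<n}" for u v w
  \<comment> \<open>\<open>metric_cost\<close> speaks about arcs only, hence about distinct
    vertices; the remaining cases follow from the zero diagonal and non-negativity.\<close>
  proof (cases "u = v \<or> v = w \<or> u = w")
    case True
    then show ?thesis using that c by (auto simp: C_def zero_diag_def)
  next
    case False
    then show ?thesis
      using that metric by (auto simp: C_def zero_diag_def metric_cost_def complete_graph_def)
  qed
qed

lemma N_iff: "N u v \<longleftrightarrow> (u, v) \<in> T \<and> \<not> one_way (edge_cost I) (u, v)"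
  using T_subset by (auto simp: keep_def t_def C_def zero_diag_def one_way_def complete_graph_def)

lemma set_hs: "set hs = {v. v < n \<and> \<not> (\<exists>u. N u v)}"
  using T_subset by (auto simp: hs_def tops_def covered_def N_iff complete_graph_def)

text \<open>Makes the head \<open>r\<close> the smallest kernel vertex, on which the comparisons
  that produce the star matrix rely.\<close>

lemma sorted_hs: "sorted_wrt (<) hs"
  unfolding hs_def tops_def by (intro sorted_wrt_filter) auto

lemma distinct_hs: "distinct hs"
  unfolding hs_def tops_def by simp

sublocale metric_forest "{..<n}" C N "set hs"
proof
  from arborescence obtain s where s: "s < n" "\<forall>u. (u, s) \<notin> T"
    and unique: "\<forall>u u' v. (u, v) \<in> T \<longrightarrow> (u', v) \<in> T \<longrightarrow> u = u'"
    and reach: "\<forall>v<n. (s, v) \<in> T\<^sup>*" by blast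
  show "finite {..<n}" by simp
  show "u \<in> {..<n}" "v \<in> {..<n}" if "N u v" for u v
    using that T_subset by (auto simp: N_iff complete_graph_def)
  show "C (v, u) \<le> C (u, v)" if "N u v" for u v
    using that by (simp add: keep_def)
  show "u = u'" if "N u v" "N u' v" for u u' v using that unique by (auto simp: N_iff)
  show "set hs \<subseteq> {..<n}" by (auto simp: set_hs)
  have "s \<in> set hs" using s by (auto simp: set_hs N_iff)
  then show "set hs \<noteq> {}" by auto
  show "S = {..<n}" if S: "set hs \<subseteq> S" "S \<subseteq> {..<n}" "\<And>u v. u \<in> S \<Longrightarrow> N u v \<Longrightarrow> v \<in> S" for S
  proof -
    have "v \<in> S" if "(s, v) \<in> T\<^sup>*" for v
      using that
    proof (induction rule: rtrancl_induct)
      case base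
      then show ?case using \<open>s \<in> set hs\<close> S by blast
    next
      case (step u v)
      show ?case
      proof (cases "N u v")
        case True
        then show ?thesis using S(3) step by blast
      next
        case False
        \<comment> \<open>Here \<open>(u, v)\<close> is one-way and is the only arc of
          \<open>T\<close> into \<open>v\<close>, so \<open>v\<close> has no parent in
          \<open>N\<close>. The induction follows \<open>T\<close> from its root, which is a kernel
          vertex as well.\<close>
        then have "v \<in> set hs"
          using step(2) unique T_subset by (auto simp: set_hs N_iff complete_graph_def)
        then show ?thesis using S by blast
      qed
    qed
    then show ?thesis using reach S(2) by auto
  qed
qed

lemma n_pos: "0 < n" using arborescence by auto

lemma V_nonempty: "{..<n} \<noteq> {}" using n_pos by (simp add: lessThan_empty_iff)

lemma hs_Cons: "hs = r # tl hs" using H_nonempty unfolding r_def by (cases hs) auto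

lemma r_less: "r < n" using hs_Cons H_in_V by (metis lessThan_iff list.set_intros(1) subsetD)

text \<open>A kernel vertex other than the root of \<open>T\<close> has an incoming arc in
  \<open>T\<close> that is missing from \<open>N\<close>, so this arc is one-way; the root accounts
  for the \<open>+ 1\<close>.\<close>

lemma length_hs: "length hs \<le> k + 1"
proof -
  from arborescence obtain s where reach: "\<forall>v<n. (s, v) \<in> T\<^sup>*" by blast
  have "set hs \<subseteq> insert s (snd ` {e \<in> T. one_way (edge_cost I) e})"
  proof
    fix v assume v: "v \<in> set hs"
    show "v \<in> insert s (snd ` {e \<in> T. one_way (edge_cost I) e})"
    proof (cases "v = s")
      case False
      have "(s, v) \<in> T\<^sup>*" using v reach by (auto simp: set_hs)
      then obtain u where "(u, v) \<in> T" using False by (metis rtranclE)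
      with v have "one_way (edge_cost I) (u, v)" by (auto simp: set_hs N_iff)
      with \<open>(u, v) \<in> T\<close> show ?thesis by force
    qed simp
  qed
  then have "card (set hs) \<le> card (insert s (snd ` {e \<in> T. one_way (edge_cost I) e}))"
    using finite_T by (intro card_mono) auto
  also have "\<dots> \<le> Suc (card (snd ` {e \<in> T. one_way (edge_cost I) e}))" by (rule card_insert_le_m1) auto
  also have "card (snd ` {e \<in> T. one_way (edge_cost I) e}) \<le> k"
    unfolding k_eq using finite_T by (intro card_image_le) auto
  finally show ?thesis using distinct_card[OF distinct_hs] by simp
qed

lemma sum_T: "sum (edge_cost I) T = sum C T"
  using T_subset by (intro sum.cong) (auto simp: C_def zero_diag_def complete_graph_def)

lemma forest_cost_le: "forest_cost {..<n} \<le> sum C T"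
  unfolding forest_cost_def
  by (rule sum_mono2[OF finite_T])
    (use T_subset nonneg in \<open>auto simp: N_iff complete_graph_def\<close>)

lemma sum_T_le_tour:
  assumes "distinct xs" "set xs = {..<n}"
  shows "sum C T \<le> tour_len C xs"
proof -
  have "xs \<noteq> []" using assms(2) V_nonempty by (metis empty_set)
  then obtain x ys where xs: "xs = x # ys" by (cases xs) auto
  let ?A = "set (zip (x # ys) ys)"
  have reach: "(x, v) \<in> (set (zip (x # ys) ys))\<^sup>*" if "v \<in> set (x # ys)" for v :: nat and x ys
    using that
  proof (induction ys arbitrary: x)
    case (Cons y ys)
    show ?case
    proof (cases "v = x")
      case False
      then have "(y, v) \<in> (set (zip (y # ys) ys))\<^sup>*" using Cons by simp
      then have "(y, v) \<in> (set (zip (x # y # ys) (y # ys)))\<^sup>*"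
        by (rule rtrancl_mono[THEN subsetD, rotated]) auto
      then show ?thesis by (rule converse_rtrancl_into_rtrancl[rotated]) simp
    qed simp
  qed simp
  have A: "?A \<subseteq> parcs (complete_graph n)"
  proof
    fix e assume e: "e \<in> ?A"
    obtain a b where ab: "e = (a, b)" by (cases e)
    from e ab obtain i where i: "i < length ys" "a = (x # ys) ! i" "b = (x # ys) ! Suc i"
      by (auto simp: in_set_zip)
    then have "a \<noteq> b"
      using nth_eq_iff_index_eq[of "x # ys" i "Suc i"] assms(1) unfolding xs by auto
    moreover have "a \<in> set xs" "b \<in> set xs"
      unfolding xs i(2,3) by (rule nth_mem, use i(1) in simp)+
    ultimately show "e \<in> parcs (complete_graph n)" unfolding ab assms(2) by (simp add: complete_graph_def)
  qed
  have "spanning_arborescence (with_proj \<lparr>pverts = {..<n}, parcs = ?A\<rparr>) (with_proj (complete_graph n))"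
    unfolding spanning_arborescence_complete_iff
  proof (intro conjI exI[of _ x] allI impI)
    show "(u, x) \<notin> ?A" for u using assms(1) xs by (auto dest: set_zip_rightD)
    show "u = u'" if "(u, v) \<in> ?A" "(u', v) \<in> ?A" for u u' v
      using that assms(1) xs by (auto simp: in_set_zip nth_eq_iff_index_eq)
    show "(x, v) \<in> ?A\<^sup>*" if "v < n" for v
    proof (rule reach)
      show "v \<in> set (x # ys)" using that assms(2) unfolding xs by blast
    qed
  qed (use A assms(2) xs in auto)
  then have "sum (edge_cost I) T \<le> sum (edge_cost I) ?A"
    using min_arb unfolding min_spanning_arborescence_def by fastforce
  also have "sum (edge_cost I) ?A = sum C ?A"
    using A by (intro sum.cong) (auto simp: C_def zero_diag_def complete_graph_def)
  also have "\<dots> = sum_list (map C (zip (x # ys) ys))"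
    using assms(1) xs by (intro sum_list_distinct_conv_sum_set[symmetric] distinct_zipI1) auto
  also have "\<dots> = path_len C (x # ys)"
    by (rule sum_list_zip_tl)
  \<comment> \<open>What separates path and tour is the closing arc from the last vertex
    \<open>z\<close> to \<open>x\<close>, whose cost is non-negative.\<close>
  also have "\<dots> \<le> tour_len C xs"
  proof -
    obtain zs z where z: "x # ys = zs @ [z]" by (metis rev_exhaust list.discI)
    have "z \<in> set xs" unfolding xs z by simp
    moreover have "x \<in> set xs" unfolding xs by simp
    moreover have "path_len C (x # ys @ [x]) = path_len C (x # ys) + C (z, x)"
      using path_len_append[of C zs z "[x]"] z
      by (metis append.assoc append_Cons append_Nil path_len.simps(1,3) add.right_neutral)
    ultimately show ?thesis
      using nonneg[of z x] unfolding assms(2) unfolding xs tour_len_conv by simp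
  qed
  finally show ?thesis by (simp add: sum_T)
qed

lemma tour_cases:
  assumes "tour n p"
  obtains xs where "distinct xs" "set xs = {..<n}" "p = tour_of xs"
    "sum_list (map (edge_cost I) p) = tour_len C xs"
  using assms cost_tour_of unfolding tour_iff_tour_of C_def by metis

lemma tour_of_solution:
  assumes "distinct xs" "set xs = {..<n}"
  shows "tour n (tour_of xs)" "sum_list (map (edge_cost I) (tour_of xs)) = tour_len C xs"
proof -
  have "xs \<noteq> []" using assms(2) V_nonempty by (metis empty_set)
  then show "tour n (tour_of xs)" "sum_list (map (edge_cost I) (tour_of xs)) = tour_len C xs"
    using assms tour_iff_tour_of cost_tour_of unfolding C_def by blast+
qed

text \<open>\<open>opt\<close> is an infimum of reals, so this direction rests on a lower bound for
  all tour costs, and \<open>le_opt\<close> on the existence of a tour.\<close>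

lemma opt_le:
  assumes "distinct xs" "set xs = {..<n}"
  shows "opt metric_ATSP I \<le> tour_len C xs"
  unfolding opt_def
proof (rule cINF_lower2[of _ _ "tour_of xs"])
  have "0 \<le> sum_list (map (edge_cost I) p)" if "tour n p" for p
    using that by (rule tour_cases) (simp add: tour_len_nonneg)
  then show "bdd_below ((\<lambda>s. sol_cost metric_ATSP I s) ` {s. is_sol metric_ATSP I s})"
    by (intro bdd_belowI[of _ 0]) auto
qed (use tour_of_solution[OF assms] in auto)

lemma le_opt:
  assumes "\<And>xs. distinct xs \<Longrightarrow> set xs = {..<n} \<Longrightarrow> x \<le> tour_len C xs"
  shows "x \<le> opt metric_ATSP I"
  unfolding opt_def
proof (rule cINF_greatest)
  show "{s. is_sol metric_ATSP I s} \<noteq> {}"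
    using tour_of_solution(1)[of "[0..<n]"] by (auto simp: atLeast0LessThan)
  fix y assume "y \<in> {s. is_sol metric_ATSP I s}"
  then have "tour n y" by simp
  then show "x \<le> sol_cost metric_ATSP I y" by (rule tour_cases) (simp add: assms)
qed

section \<open>The kernel instance and its encoding\<close>

definition kernel_cost :: "nat \<times> nat \<Rightarrow> real" where
  "kernel_cost = (\<lambda>(i, j). C (hs ! i, hs ! j) - C (r, hs ! j) + C (r, hs ! i))"

definition kernel :: atsp_inst where
  "kernel = \<lparr>vertex_count = length hs, edge_cost = kernel_cost,
    given_arborescence = {(0, j) | j. 0 < j \<and> j < length hs}\<rparr>"

lemma kernel_simps:
  "vertex_count kernel = length hs" "edge_cost kernel = kernel_cost"
  "given_arborescence kernel = {(0, j) | j. 0 < j \<and> j < length hs}"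
  by (simp_all add: kernel_def)

definition kernel_param :: nat where
  "kernel_param = length (filter (\<lambda>v. 0 < C (v, r) + C (r, v)) hs)"

lemma nth_hs: "i < length hs \<Longrightarrow> hs ! i < n"
  using H_in_V nth_mem by blast

lemma hs_0: "hs ! 0 = r" by (subst hs_Cons) simp

lemma length_hs_pos: "0 < length hs" by (subst hs_Cons) simp

lemma kernel_cost_0: "j < length hs \<Longrightarrow> kernel_cost (0, j) = 0"
  using self[of r] r_less by (simp add: kernel_cost_def hs_0)

text \<open>Non-negativity is the triangle inequality for the way from \<open>r\<close> through the
  first vertex to the second. In the triangle inequality itself the potential of the middle vertex
  cancels and those of the end vertices agree on both sides.\<close>

lemma metric_kernel: "metric_cost (with_proj (complete_graph (length hs))) kernel_cost"
  unfolding metric_cost_def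
proof (intro conjI ballI allI impI)
  fix e assume "e \<in> arcs_ends (with_proj (complete_graph (length hs)))"
  then obtain i j where "e = (i, j)" "i < length hs" "j < length hs"
    by (auto simp: complete_graph_def)
  then show "0 \<le> kernel_cost e"
    using triangle[of r "hs ! i" "hs ! j"] nth_hs r_less by (auto simp: kernel_cost_def)
next
  fix u v w
  assume "(u, v) \<in> arcs_ends (with_proj (complete_graph (length hs)))"
    "(v, w) \<in> arcs_ends (with_proj (complete_graph (length hs)))"
  then have "u < length hs" "v < length hs" "w < length hs" by (auto simp: complete_graph_def)
  then show "kernel_cost (u, w) \<le> kernel_cost (u, v) + kernel_cost (v, w)"
    using triangle[of "hs ! u" "hs ! v" "hs ! w"] nth_hs by (auto simp: kernel_cost_def)
qed

lemma kernel_param_eq: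
  "kernel_param = card {e \<in> {(0, j) | j. 0 < j \<and> j < length hs}. one_way kernel_cost e}"
proof -
  let ?P = "\<lambda>v. 0 < C (v, r) + C (r, v)"
  have P: "one_way kernel_cost (0, j) \<longleftrightarrow> ?P (hs ! j)" if "j < length hs" for j
    using that self[of r] r_less by (simp add: one_way_def kernel_cost_def hs_0 add.commute)
  have "\<not> ?P (hs ! 0)" using self[of r] r_less by (simp add: hs_0)
  then have "{j. j < length hs \<and> ?P (hs ! j)} = {j. 0 < j \<and> j < length hs \<and> ?P (hs ! j)}"
    by (metis (lifting) gr0I)
  then have "kernel_param = card {j. 0 < j \<and> j < length hs \<and> ?P (hs ! j)}"
    unfolding kernel_param_def length_filter_conv_card by simp
  also have "\<dots> = card (Pair (0::nat) ` {j. 0 < j \<and> j < length hs \<and> ?P (hs ! j)})"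
    by (rule card_image[symmetric]) (simp add: inj_on_def)
  also have "Pair 0 ` {j. 0 < j \<and> j < length hs \<and> ?P (hs ! j)} =
      {e \<in> {(0, j) | j. 0 < j \<and> j < length hs}. one_way kernel_cost e}"
    using P by auto
  finally show ?thesis .
qed

lemma is_inst_kernel: "atsp_is_inst kernel kernel_param"
proof -
  let ?S = "{(0::nat, j) | j. 0 < j \<and> j < length hs}" and ?G = "with_proj (complete_graph (length hs))"
  have "spanning_arborescence (with_proj \<lparr>pverts = {..<length hs}, parcs = ?S\<rparr>) ?G"
    unfolding spanning_arborescence_complete_iff
  proof (intro conjI exI[of _ 0] allI impI)
    show "(0, v) \<in> ?S\<^sup>*" if "v < length hs" for v
    proof (cases v)
      case (Suc w)
      then have "(0, v) \<in> ?S" using that by auto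
      then show ?thesis ..
    qed simp
  qed (use length_hs_pos in \<open>auto simp: complete_graph_def\<close>)
  moreover have "sum kernel_cost ?S \<le> sum kernel_cost (arcs H')" if "spanning_arborescence H' ?G" for H'
  proof -
    \<comment> \<open>The star is minimal because it costs nothing and no arc has negative
      cost.\<close>
    have "sum kernel_cost ?S = 0" by (rule sum.neutral) (auto simp: kernel_cost_0)
    also have "0 \<le> sum kernel_cost (arcs H')"
    proof (rule sum_nonneg)
      fix e assume "e \<in> arcs H'"
      then have "e \<in> arcs_ends ?G"
        using that by (auto simp: spanning_arborescence_def spanning_def subgraph_def)
      then show "0 \<le> kernel_cost e" using metric_kernel unfolding metric_cost_def by blast
    qed
    finally show ?thesis .
  qed
  ultimately show ?thesis
    using metric_kernel kernel_param_eq
    by (simp add: atsp_is_inst_def kernel_def min_spanning_arborescence_def)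
qed

lemma hs_less_iff: "i < length hs \<Longrightarrow> j < length hs \<Longrightarrow> hs ! i < hs ! j \<longleftrightarrow> i < j"
  using sorted_hs by (metis sorted_wrt_nth_less linorder_neqE_nat less_asym less_irrefl)

lemma enc_param_kernel:
  "enc_param metric_ATSP kernel kernel_param =
    Node (Node (Num (real (length hs)))
      (Node (enc_list (\<lambda>a. enc_list (\<lambda>b. Num (C (a, b) - C (r, b) + C (r, a))) hs) hs)
        (enc_list (\<lambda>a. enc_list (\<lambda>b. Num (of_bool (a \<le> r \<and> r < b))) hs) hs)))
      (Num (real (length (filter (\<lambda>v. 0 < C (v, r) + C (r, v)) hs))))"
proof -
  have "enc_list (\<lambda>a. enc_list (\<lambda>b. Num (C (a, b) - C (r, b) + C (r, a))) hs) hs =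
      enc_matrix (length hs) (\<lambda>(u, v). if u = v then 0 else kernel_cost (u, v))"
    unfolding enc_matrix_def enc_list_nth[of _ hs]
    \<comment> \<open>On the diagonal the two potentials cancel and \<open>C\<close> vanishes, so
      writing 0 there changes nothing.\<close>
    using self nth_hs by (intro enc_list_cong) (auto simp: kernel_cost_def)
  moreover have "enc_list (\<lambda>a. enc_list (\<lambda>b. Num (of_bool (a \<le> r \<and> r < b))) hs) hs =
      enc_matrix (length hs) (\<lambda>e. if e \<in> {(0, j) | j. 0 < j \<and> j < length hs} then 1 else 0)"
    unfolding enc_matrix_def enc_list_nth[of _ hs]
  proof (intro enc_list_cong, goal_cases)
    case (1 i j)
    then show ?case
      \<comment> \<open>As \<open>r\<close> sits at position 0 of the increasing list,
        \<open>a \<le> r\<close> means position 0 and \<open>r < b\<close> a positive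
        position.\<close>
      using hs_less_iff[of 0 i] hs_less_iff[of 0 j] length_hs_pos
      by (auto simp: hs_0 linorder_not_less[symmetric])
  qed
  ultimately show ?thesis
    unfolding enc_param_def metric_ATSP_simps enc_atsp_inst_def kernel_simps kernel_param_def by simp
qed

lemma enc_param_eq: "enc_param metric_ATSP I k' = enc_input n C t (Num (real k'))"
  by (simp add: enc_param_def enc_atsp_inst_def enc_input_def C_def t_def zero_diag_def)

lemma sem_kernel:
  "sem (call (main # lib) n 6) [enc_param metric_ATSP I k] kernel_main =
    Some (enc_param metric_ATSP kernel kernel_param)"
  unfolding enc_param_eq enc_param_kernel
  by (rule sem_kernel_main[OF hs_Cons[unfolded hs_def] hs_def])

end

section \<open>Injectivity and size of the encodings\<close>

lemma enc_list_inject: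
  assumes "enc_list f xs = enc_list g xs" "x \<in> set xs"
  shows "f x = g x"
  using assms by (induction xs) auto

text \<open>Equal encodings leave costs of loops and outside the vertex range undetermined, so an
  instance output by the kernelization can be compared with \<open>kernel\<close> only entry by
  entry.\<close>

lemma enc_matrix_inject:
  assumes "enc_matrix n f = enc_matrix n g" "i < n" "j < n"
  shows "f (i, j) = g (i, j)"
  using assms enc_list_inject[of "\<lambda>u. enc_list (\<lambda>v. Num (f (u, v))) [0..<n]" "[0..<n]"
      "\<lambda>u. enc_list (\<lambda>v. Num (g (u, v))) [0..<n]" i]
    enc_list_inject[of "\<lambda>v. Num (f (i, v))" "[0..<n]" "\<lambda>v. Num (g (i, v))" j]
  unfolding enc_matrix_def by auto

lemma data_size_enc_matrix: "data_size (enc_matrix n f) = n * (2 * n + 2) + 1"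
proof -
  have row: "data_size (enc_list (\<lambda>v. Num (g v)) xs) = 2 * length xs + 1" for g :: "'b \<Rightarrow> real" and xs
    by (induction xs) auto
  have "data_size (enc_list (\<lambda>u. enc_list (\<lambda>v. Num (f (u, v))) [0..<n]) ys) =
      length ys * (2 * n + 2) + 1" for ys
    by (induction ys) (auto simp: row)
  from this[of "[0..<n]"] show ?thesis unfolding enc_matrix_def by simp
qed

lemma data_size_enc_tour: "data_size (enc_tour p) = 4 * length p + 1"
  unfolding enc_tour_def by (induction p) auto

lemma data_size_enc_param:
  "data_size (enc_param metric_ATSP I k) = 2 * (vertex_count I * (2 * vertex_count I + 2)) + 7"
  by (simp add: enc_param_def enc_atsp_inst_def data_size_enc_matrix)

lemma vertex_count_le: "vertex_count I \<le> data_size (enc_param metric_ATSP I k)"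
  unfolding data_size_enc_param by simp

section \<open>Lifting tours of an instance that is encoded like the kernel\<close>

locale atsp_lift = atsp_instance +
  fixes I' k'
  assumes inst': "atsp_is_inst I' k'"
    and out: "enc_param metric_ATSP I' k' = enc_param metric_ATSP kernel kernel_param"
begin

sublocale K: atsp_instance I' k'
  by unfold_locales (rule inst')

lemma K_n: "K.n = length hs"
  using out by (simp add: enc_param_def enc_atsp_inst_def kernel_def)

lemma K_cost:
  assumes "set is = {..<length hs}"
  shows "tour_len K.C is = tour_len C (map ((!) hs) is)"
proof -
  have "tour_len K.C is = tour_len kernel_cost is"
  proof (rule tour_len_cong)
    fix i j assume "i \<in> set is" "j \<in> set is"
    then have ij: "i < length hs" "j < length hs" using assms by auto
    have "enc_atsp_inst I' = enc_atsp_inst kernel" using out by (simp add: enc_param_def)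
    then have "enc_matrix (length hs) K.C = enc_matrix (length hs) (zero_diag kernel_cost)"
      unfolding enc_atsp_inst_def K_n kernel_simps by (simp add: K.C_def zero_diag_def)
    from enc_matrix_inject[OF this ij] show "K.C (i, j) = kernel_cost (i, j)"
      using self nth_hs ij by (auto simp: zero_diag_def kernel_cost_def)
  qed
  also have "\<dots> = tour_len (\<lambda>(i, j). (\<lambda>(i, j). C (hs ! i, hs ! j)) (i, j) - C (r, hs ! j) + C (r, hs ! i)) is"
    by (simp add: kernel_cost_def)
  also have "\<dots> = tour_len (\<lambda>(i, j). C (hs ! i, hs ! j)) is" by (rule tour_len_potential)
  finally show ?thesis unfolding tour_len_map .
qed

text \<open>A tour is shortcut to the kernel vertices and renamed to their positions in
  \<open>hs\<close>; the shifted costs give the renamed tour the same length, as the potentials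
  cancel.\<close>

lemma opt_kernel_le: "opt metric_ATSP I' \<le> opt metric_ATSP I"
proof (rule le_opt)
  fix xs assume xs: "distinct xs" "set xs = {..<n}"
  let ?ys = "filter (\<lambda>v. v \<in> set hs) xs"
  have ys: "set ?ys = set hs" using H_in_V xs(2) by auto
  have "\<exists>is. set is \<subseteq> {..<length hs} \<and> ?ys = map ((!) hs) is"
  proof -
    have "\<forall>y\<in>set ?ys. \<exists>i<length hs. hs ! i = y" unfolding ys by (metis in_set_conv_nth)
    then obtain f where f: "\<forall>y\<in>set ?ys. f y < length hs \<and> hs ! f y = y" by metis
    then have "map ((!) hs) (map f ?ys) = ?ys" unfolding map_map by (intro map_idI) simp
    with f show ?thesis by (intro exI[of _ "map f ?ys"]) auto
  qed
  then obtain "is" where "is": "set is \<subseteq> {..<length hs}" "?ys = map ((!) hs) is" by blast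
  have "distinct (map ((!) hs) is)" using xs(1) "is"(2) by (metis distinct_filter)
  then have d: "distinct is" by (simp add: distinct_map)
  \<comment> \<open>Being distinct and as long as \<open>hs\<close>, the list \<open>is\<close> uses
    every position.\<close>
  have "card (set is) = length hs"
    using distinct_card[OF d] distinct_card[OF distinct_hs] distinct_card[of ?ys] ys "is"(2) xs(1)
    by (metis distinct_filter length_map)
  then have s: "set is = {..<length hs}" using "is"(1) by (intro card_subset_eq) auto
  have "opt metric_ATSP I' \<le> tour_len K.C is"
    by (rule K.opt_le) (use d s K_n in auto)
  also have "\<dots> = tour_len C ?ys" unfolding K_cost[OF s] "is"(2) ..
  also have "\<dots> \<le> tour_len C xs"
    by (rule tour_len_filter) (use xs(2) ys H_nonempty in \<open>auto simp del: set_filter\<close>)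
  finally show "opt metric_ATSP I' \<le> tour_len C xs" .
qed

lemma lift:
  assumes s: "tour K.n s"
  obtains xs where "distinct xs" "set xs = {..<n}"
    "\<And>main. sem (call (main # lib) n 6) [enc_lift metric_ATSP I k I' k' s] lift_main =
      Some (enc_tour (tour_of xs))"
    "tour_len C xs \<le> sum_list (map (edge_cost I') s) + 2 * opt metric_ATSP I"
proof -
  from K.tour_cases[OF s] obtain "is" where d: "distinct is" and "set is = {..<K.n}"
    and s_eq: "s = tour_of is" and cost: "sum_list (map (edge_cost I') s) = tour_len K.C is" .
  then have set_is: "set is = {..<length hs}" using K_n by simp
  have len: "length is = length hs" using distinct_card[OF d] set_is by simp
  define L where "L = map ((!) hs) is"
  define xs where "xs = extend_rounds N [0..<n] [0..<n] L"
  have "set L = set hs" unfolding L_def set_map set_is by (auto simp: set_conv_nth)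
  moreover have dL: "distinct L"
    unfolding L_def distinct_map using d set_is distinct_hs by (auto simp: inj_on_def nth_eq_iff_index_eq)
  ultimately have xs: "distinct xs" "set xs = {..<n}"
    "tour_len C xs \<le> tour_len C L + 2 * forest_cost {..<n}"
    unfolding xs_def using extend_rounds_spans[of L "[0..<n]" "[0..<n]"] by (auto simp: atLeast0LessThan)
  have length_xs: "length xs = n" using distinct_card[OF xs(1)] xs(2) by simp
  have s_bounds: "fst ` set s \<subseteq> {..<length hs}" "length s \<le> n"
  proof -
    have "set (map fst (cyclic_arcs is)) \<subseteq> {..<length hs}" using set_is by simp
    then show "fst ` set s \<subseteq> {..<length hs}"
      unfolding s_eq tour_of_def by (auto simp del: map_fst_cyclic_arcs)
    show "length s \<le> n"
      using len length_tops[of C t n] unfolding s_eq tour_of_def hs_def by auto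
  qed
  have L_eq: "L = (if s = [] then hs else map (\<lambda>e. hs ! fst e) s)"
  proof (cases "length is = 1")
    \<comment> \<open>The kernel tour is empty and says nothing about the vertex, but
      \<open>hs\<close> is then the only possible vertex list.\<close>
    case True
    obtain i where i: "is = [i]" using True by (metis One_nat_def length_0_conv length_Suc_conv)
    obtain h where h: "hs = [h]" using True len by (metis One_nat_def length_0_conv length_Suc_conv)
    have "i = 0" using set_is unfolding i h by auto
    then show ?thesis unfolding s_eq L_def tour_of_def i h by simp
  next
    case False
    then have eq: "s = cyclic_arcs is" by (simp add: s_eq tour_of_def)
    have "length s \<noteq> 0" using len length_hs_pos unfolding eq length_cyclic_arcs by simp
    moreover have "map (\<lambda>e. hs ! fst e) s = map ((!) hs) (map fst s)" by simp
    moreover have "s \<noteq> []" using calculation(1) by auto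
    ultimately show ?thesis unfolding L_def by (simp add: eq)
  qed
  have grown_L: "grown (tour_len C L) L"
    using dL \<open>set L = set hs\<close> H_in_V forest_cost_nonneg by (auto simp: grown_def)
  have grown_bound: "set L' \<subseteq> {..<n} \<and> length L' \<le> n" if "grown (tour_len C L) L'" for L'
  proof -
    have "set L' \<subseteq> {..<n}" "distinct L'" using that by (auto simp: grown_def)
    moreover from this have "card (set L') \<le> card {..<n}" by (intro card_mono) auto
    ultimately show ?thesis using distinct_card[of L'] by simp
  qed
  have "xs \<noteq> []" using length_xs n_pos by auto
  have sem: "sem (call (main # lib) n 6)
      [Node (enc_input n C t (Num (real k))) (Node (enc_param metric_ATSP I' k') (enc_tour s))] lift_main =
    Some (enc_tour (if length xs = 1 then [] else cyclic_arcs xs))" for main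
    by (rule sem_lift_main[where I = "grown (tour_len C L)", OF hs_Cons[unfolded hs_def] hs_def L_eq
        s_bounds grown_L grown_extend grown_bound xs_def \<open>xs \<noteq> []\<close>]) (simp_all add: length_xs)
  \<comment> \<open>\<open>forest_cost\<close> is at most the cost of \<open>T\<close>, which bounds
    every tour from below and hence the infimum.\<close>
  have "2 * forest_cost {..<n} \<le> 2 * opt metric_ATSP I"
    using order_trans[OF forest_cost_le le_opt[OF sum_T_le_tour]] by simp
  then have "tour_len C xs \<le> sum_list (map (edge_cost I') s) + 2 * opt metric_ATSP I"
    using xs(3) unfolding cost K_cost[OF set_is] L_def by simp
  with xs(1,2) sem show ?thesis
    by (intro that[of xs]) (auto simp: enc_lift_def enc_param_eq tour_of_def)
qed

end

section \<open>Size bound, running times and approximation guarantee\<close>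

lemma metric_ATSP_kernelization:
  "linear_additive_lossy_kernelization 2 metric_ATSP (kernel_main # lib) (lift_main # lib)"
  unfolding linear_additive_lossy_kernelization_def
\<comment> \<open>Both coefficients are 2: the kernel has at most \<open>k + 1\<close> vertices, and
  its parameter counts some of them.\<close>
proof (intro conjI exI[of _ 2] allI impI)
  let ?K = "kernel_main # lib" and ?L = "lift_main # lib"
  \<comment> \<open>Evaluation is deterministic, so any instance that the kernelization outputs
    shares its encoding with \<open>kernel\<close>; this is the assumption of
    \<open>atsp_lift\<close>.\<close>
  have out_K: "outputs ?K (enc_param metric_ATSP I k) z \<longleftrightarrow>
      z = enc_param metric_ATSP (atsp_instance.kernel I) (atsp_instance.kernel_param I)"
    if "atsp_is_inst I k" for I k z
    using atsp_instance.sem_kernel[of I k] that by (intro outputs_main) (auto simp: atsp_instance_def)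
  have atsp_liftI: "atsp_lift I k I' k'" if "is_inst metric_ATSP I k" "is_inst metric_ATSP I' k'"
    "outputs ?K (enc_param metric_ATSP I k) (enc_param metric_ATSP I' k')" for I k I' k'
    using that out_K by (auto simp: atsp_lift_def atsp_lift_axioms_def atsp_instance_def)
  show "poly_time_on (kernel_inputs metric_ATSP) ?K"
  proof (rule poly_time_onI[where b = "\<lambda>n. 2 * (n * (2 * n + 2)) + 7"])
    show "poly_bounded (\<lambda>n. 2 * (n * (2 * n + 2)) + 7)"
      by (intro poly_bounded_add poly_bounded_mult poly_bounded_const poly_bounded_id)
    fix x assume "x \<in> kernel_inputs metric_ATSP"
    then obtain I k where x: "x = enc_param metric_ATSP I k" and "atsp_is_inst I k"
      by (auto simp: kernel_inputs_def)
    then interpret atsp_instance I k by unfold_locales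
    have "length hs \<le> n" unfolding hs_def by (rule length_tops)
    then have "length hs * (2 * length hs + 2) \<le> n * (2 * n + 2)" by (intro mult_le_mono) auto
    then have "data_size (enc_param metric_ATSP kernel kernel_param) \<le> 2 * (n * (2 * n + 2)) + 7"
      unfolding data_size_enc_param kernel_simps by simp
    then show "\<exists>n y. n \<le> data_size x \<and> sem (call ?K n 6) [x] kernel_main = Some y \<and>
        data_size y \<le> 2 * (n * (2 * n + 2)) + 7"
      unfolding x using sem_kernel vertex_count_le by blast
  qed
  show "poly_time_on (lift_inputs metric_ATSP ?K) ?L"
  proof (rule poly_time_onI[where b = "\<lambda>n. 4 * n + 1"])
    show "poly_bounded (\<lambda>n. 4 * n + 1)"
      by (intro poly_bounded_add poly_bounded_mult poly_bounded_const poly_bounded_id)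
    fix x assume "x \<in> lift_inputs metric_ATSP ?K"
    then obtain I k I' k' s where x: "x = enc_lift metric_ATSP I k I' k' s"
      and "is_inst metric_ATSP I k" "is_inst metric_ATSP I' k'"
        "outputs ?K (enc_param metric_ATSP I k) (enc_param metric_ATSP I' k')"
      and s: "tour (vertex_count I') s" by (auto simp: lift_inputs_def)
    then interpret atsp_lift I k I' k' using atsp_liftI by blast
    obtain xs where xs: "distinct xs" "set xs = {..<n}"
      "sem (call ?L n 6) [x] lift_main = Some (enc_tour (tour_of xs))"
      using lift[OF s] unfolding x by metis
    have "length xs = n" using distinct_card[OF xs(1)] xs(2) by simp
    then have "data_size (enc_tour (tour_of xs)) \<le> 4 * n + 1"
      by (simp add: data_size_enc_tour tour_of_def)
    moreover have "n \<le> data_size x"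
      using vertex_count_le[of I k] unfolding x enc_lift_def by simp
    ultimately show "\<exists>n y. n \<le> data_size x \<and> sem (call ?L n 6) [x] lift_main = Some y \<and>
        data_size y \<le> 4 * n + 1"
      using xs(3) by blast
  qed
  fix I k
  assume I: "is_inst metric_ATSP I k"
  show "\<exists>I' k'. is_inst metric_ATSP I' k' \<and>
      outputs ?K (enc_param metric_ATSP I k) (enc_param metric_ATSP I' k') \<and>
      inst_size metric_ATSP I' + k' \<le> 2 * k + 2"
  proof -
    interpret atsp_instance I k using I by unfold_locales simp
    have "kernel_param \<le> length hs" unfolding kernel_param_def by (rule length_filter_le)
    then have "vertex_count kernel + kernel_param \<le> 2 * k + 2"
      using length_hs unfolding kernel_simps by linarith
    then show ?thesis
      using is_inst_kernel out_K[OF inst]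
      by (intro exI[of _ kernel] exI[of _ kernel_param]) (simp only: metric_ATSP_simps simp_thms)
  qed
  fix I' k' s and \<gamma> :: real
  assume I': "is_inst metric_ATSP I' k'"
    "outputs ?K (enc_param metric_ATSP I k) (enc_param metric_ATSP I' k')"
    and \<gamma>: "0 \<le> \<gamma>" and approx: "approx_sol metric_ATSP \<gamma> I' s"
  show "\<exists>s'. outputs ?L (enc_lift metric_ATSP I k I' k' s) (enc_sol metric_ATSP s') \<and>
      approx_sol metric_ATSP (\<gamma> + 2) I s'"
  proof -
    interpret atsp_lift I k I' k' using I I' atsp_liftI by blast
    from approx have s: "tour K.n s"
      and cost: "sum_list (map (edge_cost I') s) \<le> \<gamma> * opt metric_ATSP I'"
      by (auto simp: approx_sol_def)
    obtain xs where xs: "distinct xs" "set xs = {..<n}"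
      "sem (call ?L n 6) [enc_lift metric_ATSP I k I' k' s] lift_main = Some (enc_tour (tour_of xs))"
      "tour_len C xs \<le> sum_list (map (edge_cost I') s) + 2 * opt metric_ATSP I"
      using lift[OF s] by metis
    note cost
    \<comment> \<open>The factor \<open>\<gamma>\<close> acts on the kernel tour alone; lifting adds
      twice the optimum whatever \<open>\<gamma>\<close> is, which makes the loss additive.\<close>
    also have "\<gamma> * opt metric_ATSP I' \<le> \<gamma> * opt metric_ATSP I"
      using opt_kernel_le \<gamma> by (rule mult_left_mono)
    finally have "tour_len C xs \<le> (\<gamma> + 2) * opt metric_ATSP I"
      using xs(4) by (simp add: algebra_simps)
    then have "approx_sol metric_ATSP (\<gamma> + 2) I (tour_of xs)"
      using tour_of_solution[OF xs(1,2)] by (simp add: approx_sol_def)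
    moreover have "outputs ?L (enc_lift metric_ATSP I k I' k' s) (enc_tour (tour_of xs))"
      using outputs_main[OF xs(3)] by blast
    ultimately show ?thesis by auto
  qed
qed simp

theorem theorem4p4:
  shows "admits_linear_additive_lossy_kernelization 2 metric_ATSP"
  using metric_ATSP_kernelization unfolding admits_linear_additive_lossy_kernelization_def by blast

end
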